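(* Let $n\ge1$ and $\tau\in S_n$ with schedule $(w_1,\dots,w_n)$, and suppose the runs of $\tau$, from left to right, have lengths $\rho_r,\dots,\rho_1,\rho_0$. If $1\le l\le r$, then the multiset of $l$-schedule numbers $\{w^{(l)}(c):1\le c\le n\}$ equals the multiset $\{w_i:1\le i\le n\}\cup\{\rho_l\}\setminus\{\rho_0\}$. Hence $$\sum_{\substack{Pr\in \mathcal{P}ref_n\\ \operatorname{diagword}(Pr)=\tau\\ l(Pr)=l}} t^{\operatorname{area}(Pr)}q^{\operatorname{dinv}(Pr)} = t^{\operatorname{maj}(\tau)}\, q^{\rho_0+\dots+\rho_{l-1}}\,\frac{[\rho_l]_q}{[\rho_0]_q}\prod_{i=1}^n[w_i]_q.$$
   Context: Runs of a permutation are its maximal increasing contiguous segments. Schedule of $\tau\in S_n$: if the last run of $\tau$ has length $k$, set $w_i=i$ for $1\le i\le k$; for $k<i\le n$, $w_i$ is the number of elements of the run containing $\tau_{n+1-i}$ that are larger than $\tau_{n+1-i}$ plus the number of elements smaller than $\tau_{n+1-i}$ in the next run. $l$-schedule numbers: let $l\ge0$ and let $\tau$ have at least $l+1$ runs. For $1\le c\le n$: if $c$ lies in one of the last $l$ runs, $w^{(l)}(c)$ is the number of elements smaller than $c$ in its own run plus the number of elements larger than $c$ in the previous run; if $c$ lies in the $(l+1)$-st run from the end, $w^{(l)}(c)$ is the number of elements of that run weakly to the right of $c$ (counting $c$); otherwise $w^{(l)}(c)$ is the number of elements larger than $c$ in its own run plus the number of elements smaller than $c$ in the next run. A preference function on $n$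 cars is a map $f:[n]\to[n]$; $\mathcal{P}ref_n$ is the set of them. It is drawn as a labeled lattice path in the $n\times n$ grid: for $j=1,\dots,n$ in turn, the cars in $f^{-1}(j)$ are written in column $j$ in increasing order bottom to top in the lowest unused rows. A car in the cell with lower-left corner $(x,y)$ lies in diagonal $y-x$. The deviation $l(Pr)$ is the maximum over cars of minus their diagonal (always $\ge0$). $\operatorname{area}(Pr)=\sum_c(d(c)+l(Pr))$, $d(c)$ the diagonal of car $c$. $\operatorname{dinv}(Pr)$ = (number of pairs of cars in the same diagonal with the left one smaller) + (number of pairs $b<a$ with $a$ in diagonal $m+1$, $b$ in diagonal $m$, and $b$ in a column strictly right of $a$) + (number of cars in negative diagonals). $\operatorname{diagword}(Pr)$ lists the cars of each nonempty diagonal in increasing order, diagonals from highest to lowest. $\operatorname{maj}(\tau)$ is the sum of descent positions of $\tau$; $[m]_q=1+q+\dots+q^{m-1}$. *)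

theory Defs
  imports Main "HOL-Library.FuncSet" "HOL-Library.Multiset"
begin

text \<open>Permutations of [n] are represented as lists tau with distinct tau and set tau = {1..n};
  tau ! (i-1) is the i-th entry.\<close>

fun runs :: "nat list \<Rightarrow> nat list list" where
  "runs [] = []"
| "runs [x] = [[x]]"
| "runs (x # y # xs) =
     (let rs = runs (y # xs) in if x < y then (x # hd rs) # tl rs else [x] # rs)"

definition rruns :: "nat list \<Rightarrow> nat list list" where
  "rruns \<tau> = rev (runs \<tau>)"

definition rho :: "nat list \<Rightarrow> nat \<Rightarrow> nat" where
  "rho \<tau> j = length (rruns \<tau> ! j)"

definition runidx :: "nat list \<Rightarrow> nat \<Rightarrow> nat" where
  "runidx \<tau> c = (THE j. j < length (rruns \<tau>) \<and> c \<in> set (rruns \<tau> ! j))"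

definition sched :: "nat list \<Rightarrow> nat \<Rightarrow> nat" where
  "sched \<tau> i =
     (let n = length \<tau>; k = length (last (runs \<tau>)); x = \<tau> ! (n - i);
          j = runidx \<tau> x; RR = rruns \<tau>
      in if i \<le> k then i
         else card {y \<in> set (RR ! j). x < y} + card {y \<in> set (RR ! (j - 1)). y < x})"

definition schedule :: "nat list \<Rightarrow> nat list" where
  "schedule \<tau> = map (sched \<tau>) [1..<length \<tau> + 1]"

definition lsched :: "nat \<Rightarrow> nat list \<Rightarrow> nat \<Rightarrow> nat" where
  "lsched l \<tau> c =
     (let RR = rruns \<tau>; j = runidx \<tau> c; own = RR ! j
      in if j < l then card {x \<in> set own. x < c} + card {x \<in> set (RR ! (j + 1)). c < x}
         else if j = l then length (dropWhile (\<lambda>x. x \<noteq> c) own)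
         else card {x \<in> set own. c < x} + card {x \<in> set (RR ! (j - 1)). x < c})"

definition maj :: "nat list \<Rightarrow> nat" where
  "maj \<tau> = (\<Sum>i \<in> {i. 1 \<le> i \<and> i < length \<tau> \<and> \<tau> ! (i - 1) > \<tau> ! i}. i)"

definition qint :: "nat \<Rightarrow> 'a::comm_semiring_1 \<Rightarrow> 'a" where
  "qint m q = (\<Sum>i<m. q ^ i)"

text \<open>Preference functions on n cars: f in {1..n} ->E {1..n}.
  Car c sits in column f c, i.e. its cell has lower-left corner (x,y) with
  x = f c - 1 and y = number of cars placed below it (cars in earlier columns,
  plus smaller cars in the same column).\<close>
definition colx :: "(nat \<Rightarrow> nat) \<Rightarrow> nat \<Rightarrow> int" where
  "colx f c = int (f c) - 1"

definition rowy :: "nat \<Rightarrow> (nat \<Rightarrow> nat) \<Rightarrow> nat \<Rightarrow> int" where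
  "rowy n f c = int (card {d \<in> {1..n}. f d < f c} + card {d \<in> {1..n}. f d = f c \<and> d < c})"

definition diag :: "nat \<Rightarrow> (nat \<Rightarrow> nat) \<Rightarrow> nat \<Rightarrow> int" where
  "diag n f c = rowy n f c - colx f c"

definition dev :: "nat \<Rightarrow> (nat \<Rightarrow> nat) \<Rightarrow> int" where
  "dev n f = Max ((\<lambda>c. - diag n f c) ` {1..n})"

definition area :: "nat \<Rightarrow> (nat \<Rightarrow> nat) \<Rightarrow> int" where
  "area n f = (\<Sum>c\<in>{1..n}. diag n f c + dev n f)"

definition dinv :: "nat \<Rightarrow> (nat \<Rightarrow> nat) \<Rightarrow> nat" where
  "dinv n f =
     card {(a, b). a \<in> {1..n} \<and> b \<in> {1..n} \<and> diag n f a = diag n f b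
                   \<and> colx f a < colx f b \<and> a < b}
   + card {(a, b). a \<in> {1..n} \<and> b \<in> {1..n} \<and> b < a
                   \<and> diag n f a = diag n f b + 1 \<and> colx f a < colx f b}
   + card {c \<in> {1..n}. diag n f c < 0}"

text \<open>Diagonal word: cars of each diagonal in increasing order, diagonals from highest to lowest
  (all diagonals lie in [-n, n]; empty ones contribute nothing).\<close>
definition diagword :: "nat \<Rightarrow> (nat \<Rightarrow> nat) \<Rightarrow> nat list" where
  "diagword n f = concat (map (\<lambda>m. sorted_list_of_set {c \<in> {1..n}. diag n f c = m})
                              (rev [- int n..int n]))"

end

theory Submission
  imports Defs "HOL-Combinatorics.Multiset_Permutations"
begin

text \<open>
  Reading the cars row by row turns a preference function into a permutation of the cars, and once
  the diagonal of every car is prescribed the function can be recovered from this word. A word occurs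
  iff the diagonal rises by at most one at each step, the label growing whenever it rises, and the
  first and last diagonals are \<open>\<le> 0\<close> and \<open>\<ge> 0\<close>. Consequently all diagonals between the lowest and
  the highest one are occupied and consecutive ones are separated by a descent of the diagonal word,
  so the diagonals are the runs of \<open>\<tau>\<close>.

  The smallest car \<open>c\<close> of the highest diagonal can be inserted into a word of the other cars exactly
  behind the cars that it attacks (and in front if \<open>c\<close> is in diagonal \<open>0\<close>). The contributions of these
  places to \<open>dinv\<close> are \<open>0, 1, 2, \<dots>\<close>, which gives a factor \<open>[w]\<^sub>q\<close>. Reversing words and
  negating diagonals and labels handles the negative diagonals, and the resulting numbers \<open>w\<close> are the
  \<open>l\<close>-schedule numbers.

  For the multisets, let \<open>A\<close> and \<open>B\<close> be consecutive runs. Along the increasing enumeration of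
  \<open>A \<union> B\<close>, the number of larger elements of \<open>A\<close> plus smaller elements of \<open>B\<close> walks from \<open>|A|\<close> to
  \<open>|B|\<close>, stepping down at \<open>A\<close> and up at \<open>B\<close>; the schedule numbers are the lower ends of the down
  steps, the \<open>l\<close>-schedule numbers those of the up steps. Comparing the two and telescoping over the last
  \<open>l + 1\<close> runs gives the claim.
\<close>

section \<open>Words with prescribed diagonals\<close>

text \<open>Here \<open>d\<close> is the diagonal and \<open>e\<close> the label of a car; labels are integers so that they can be
  negated in the reversal symmetry.\<close>

definition adj :: "('a \<Rightarrow> int) \<Rightarrow> ('a \<Rightarrow> int) \<Rightarrow> 'a \<Rightarrow> 'a \<Rightarrow> bool" where
  "adj d e u v \<longleftrightarrow> d v \<le> d u + 1 \<and> (d v = d u + 1 \<longrightarrow> e u < e v)"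

text \<open>A car in row \<open>i\<close>, counted from 0, and diagonal \<open>d\<close> sits in
  column \<open>i - d + 1\<close>. So \<open>adj\<close> says that columns weakly increase from row
  to row, with labels growing inside a column, and the conditions at the two ends keep all columns
  between 1 and the number of rows.\<close>

definition valid :: "('a \<Rightarrow> int) \<Rightarrow> ('a \<Rightarrow> int) \<Rightarrow> 'a list \<Rightarrow> bool" where
  "valid d e w \<longleftrightarrow> successively (adj d e) w \<and> (w \<noteq> [] \<longrightarrow> d (hd w) \<le> 0 \<and> 0 \<le> d (last w))"

text \<open>For \<open>u\<close> before \<open>v\<close> in the word, these are the pairs counted by
  the first two terms of \<open>dinv\<close>.\<close>

definition attack :: "('a \<Rightarrow> int) \<Rightarrow> ('a \<Rightarrow> int) \<Rightarrow> 'a \<Rightarrow> 'a \<Rightarrow> bool" where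
  "attack d e u v \<longleftrightarrow> d u = d v \<and> e u < e v \<or> d u = d v + 1 \<and> e v < e u"

fun ninv :: "('a \<Rightarrow> 'a \<Rightarrow> bool) \<Rightarrow> 'a list \<Rightarrow> nat" where
  "ninv P [] = 0"
| "ninv P (x # xs) = length (filter (P x) xs) + ninv P xs"

definition words :: "('a \<Rightarrow> int) \<Rightarrow> ('a \<Rightarrow> int) \<Rightarrow> 'a set \<Rightarrow> 'a list set" where
  "words d e S = {w \<in> permutations_of_set S. valid d e w}"

definition wsum :: "('a \<Rightarrow> int) \<Rightarrow> ('a \<Rightarrow> int) \<Rightarrow> 'b::comm_semiring_1 \<Rightarrow> 'a set \<Rightarrow> 'b" where
  "wsum d e q S = (\<Sum>w\<in>words d e S. q ^ ninv (attack d e) w)"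

lemma ninv_insert:
  assumes "\<And>x. x \<in> set u \<Longrightarrow> \<not> P x c"
  shows "ninv P (u @ c # v) = ninv P (u @ v) + length (filter (P c) v)"
  using assms by (induction u) simp_all

lemma ninv_rev: "ninv P (rev w) = ninv (\<lambda>x y. P y x) w"
proof -
  have snoc: "ninv P (xs @ [x]) = ninv P xs + length (filter (\<lambda>y. P y x) xs)" for x xs
    by (induction xs) auto
  show ?thesis
    by (induction w) (simp_all add: snoc flip: rev_filter)
qed

text \<open>As \<open>c\<close> is the smallest car of the highest diagonal, any car may follow it,
  and a car may precede it exactly when \<open>c\<close> attacks that car. An attacked car may also
  directly precede whatever follows \<open>c\<close>, so deleting \<open>c\<close> keeps the word
  valid. In front, the condition on the first letter forces diagonal 0; \<open>bot\<close> controls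
  the last letter in that case.\<close>

lemma valid_insert:
  assumes top: "\<And>x. x \<in> set (u @ v) \<Longrightarrow> d x < d c \<or> d x = d c \<and> e c < e x"
    and "0 \<le> d c" and bot: "d c = 0 \<Longrightarrow> (\<And>x. x \<in> set (u @ v) \<Longrightarrow> 0 \<le> d x)"
  shows "valid d e (u @ c # v) \<longleftrightarrow>
    valid d e (u @ v) \<and> (if u = [] then d c = 0 else attack d e c (last u))"
proof -
  have T: "d (last u) < d c \<or> d (last u) = d c \<and> e c < e (last u)" if "u \<noteq> []"
    using top[of "last u"] that by auto
  have H: "d (hd v) < d c \<or> d (hd v) = d c \<and> e c < e (hd v)" if "v \<noteq> []"
    using top[of "hd v"] that by auto
  have B1: "0 \<le> d (last u)" if "u \<noteq> []" "d c = 0"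
    using bot[of "last u"] that by auto
  have B2: "0 \<le> d (last v)" if "v \<noteq> []" "d c = 0"
    using bot[of "last v"] that by auto
  have C: "adj d e c (hd v)" if "v \<noteq> []"
    using H[OF that] unfolding adj_def by linarith
  have P: "adj d e (last u) c \<longleftrightarrow> attack d e c (last u)" if "u \<noteq> []"
    using T[OF that] unfolding adj_def attack_def by linarith
  have A: "adj d e (last u) (hd v)" if "u \<noteq> []" "v \<noteq> []" "attack d e c (last u)"
    using H[OF that(2)] that(3) unfolding adj_def attack_def by linarith
  have E: "0 \<le> d (last u)" if "u \<noteq> []" "attack d e c (last u)"
    using B1[OF that(1)] that(2) \<open>0 \<le> d c\<close> unfolding attack_def by linarith
  show ?thesis
  proof (cases "u = []")
    case True
    show ?thesis
    proof (cases "v = []")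
      case False
      then have "d c = 0 \<Longrightarrow> d (hd v) \<le> 0" using H by linarith
      then show ?thesis using True False C B2 \<open>0 \<le> d c\<close>
        by (auto simp: valid_def successively_Cons)
    qed (use True \<open>0 \<le> d c\<close> in \<open>auto simp: valid_def\<close>)
  next
    case False
    then show ?thesis using P[OF False] A C E \<open>0 \<le> d c\<close>
      by (cases "v = []") (auto simp: valid_def successively_append_iff successively_Cons)
  qed
qed

text \<open>Cuts right behind the m letters satisfying \<open>P\<close> leave 0, 1, ..., m - 1 such
  letters behind them, each number once. The cut in front, allowed if \<open>z\<close>, contributes
  the exponent m.\<close>

lemma sum_insert_positions:
  fixes q :: "'b::comm_semiring_1"
  shows "(\<Sum>k | k \<le> length w \<and> (if take k w = [] then z else P (last (take k w))).
            q ^ length (filter P (drop k w)))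
         = qint (length (filter P w) + (if z then 1 else 0)) q"
proof -
  have main: "(\<Sum>k | 0 < k \<and> k \<le> length w \<and> P (w ! (k - 1)). q ^ length (filter P (drop k w)))
        = qint (length (filter P w)) q"
  proof (induction w)
    case Nil
    show ?case by (subst sum.neutral) (auto simp: qint_def)
  next
    case (Cons x xs)
    have "{k. 0 < k \<and> k \<le> length (x # xs) \<and> P ((x # xs) ! (k - 1))}
       = {k. k = 1 \<and> P x} \<union> Suc ` {k. 0 < k \<and> k \<le> length xs \<and> P (xs ! (k - 1))}" (is "?L = ?A \<union> ?B")
    proof (intro set_eqI)
      fix k
      show "k \<in> ?L \<longleftrightarrow> k \<in> ?A \<union> ?B"
      proof (cases k)
        case (Suc j)
        then show ?thesis by (cases j) auto
      qed auto
    qed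
    moreover have "?A \<inter> ?B = {}" by auto
    moreover have "finite ?A" "finite ?B" by auto
    ultimately have "(\<Sum>k\<in>?L. q ^ length (filter P (drop k (x # xs))))
      = (\<Sum>k\<in>?A. q ^ length (filter P (drop k (x # xs)))) + (\<Sum>k\<in>?B. q ^ length (filter P (drop k (x # xs))))"
      by (simp only: sum.union_disjoint)
    also have "(\<Sum>k\<in>?B. q ^ length (filter P (drop k (x # xs)))) = qint (length (filter P xs)) q"
      using Cons.IH by (simp add: sum.reindex)
    also have "(\<Sum>k\<in>?A. q ^ length (filter P (drop k (x # xs))))
        = (if P x then q ^ length (filter P xs) else 0)"
      by (cases "P x") auto
    finally show ?case by (simp add: qint_def add.commute)
  qed
  have eq: "{k. k \<le> length w \<and> (if take k w = [] then z else P (last (take k w)))}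
     = {k. k = 0 \<and> z} \<union> {k. 0 < k \<and> k \<le> length w \<and> P (w ! (k - 1))}"
  proof (intro set_eqI)
    fix k
    show "k \<in> {k. k \<le> length w \<and> (if take k w = [] then z else P (last (take k w)))} \<longleftrightarrow>
      k \<in> {k. k = 0 \<and> z} \<union> {k. 0 < k \<and> k \<le> length w \<and> P (w ! (k - 1))}"
      by (cases "k = 0"; cases "w = []") (auto simp: last_conv_nth min_def split: if_splits)
  qed
  have fin: "finite {k. k = 0 \<and> z}" "finite {k. 0 < k \<and> k \<le> length w \<and> P (w ! (k - 1))}"
    by auto
  have disj: "{k. k = 0 \<and> z} \<inter> {k. 0 < k \<and> k \<le> length w \<and> P (w ! (k - 1))} = {}" by auto
  show ?thesis
    unfolding eq sum.union_disjoint[OF fin disj] main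
    by (cases z) (simp_all add: qint_def add.commute)
qed

lemma takeWhile_insert: "c \<notin> set u \<Longrightarrow> takeWhile (\<lambda>x. x \<noteq> c) (u @ c # v) = u"
  by (subst takeWhile_append2) auto

text \<open>Deleting \<open>c\<close> and recording its place is a bijection from the words of
  \<open>S\<close> to pairs of a word of the other cars and a place admissible by
  \<open>valid_insert\<close>. No car attacks \<open>c\<close>, so the place adds to the statistic
  only the attacked cars behind it, and \<open>sum_insert_positions\<close> sums over the
  places.\<close>

lemma wsum_remove_top:
  fixes q :: "'b::comm_semiring_1"
  assumes "finite S" "c \<in> S" "0 \<le> d c"
    and top: "\<And>x. x \<in> S - {c} \<Longrightarrow> d x < d c \<or> d x = d c \<and> e c < e x"
    and bot: "d c = 0 \<Longrightarrow> (\<And>x. x \<in> S \<Longrightarrow> 0 \<le> d x)"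
  shows "wsum d e q S =
    qint (card {x \<in> S. attack d e c x} + (if d c = 0 then 1 else 0)) q * wsum d e q (S - {c})"
proof -
  define K where "K w = {k. k \<le> length w \<and>
     (if take k w = [] then d c = 0 else attack d e c (last (take k w)))}" for w
  have finK: "finite (K w)" for w
    by (rule finite_subset[of _ "{..length w}"]) (auto simp: K_def)
  have finW: "finite (words d e A)" for A
    by (simp add: words_def)
  let ?ins = "\<lambda>(w, k). take k w @ c # drop k w"
  let ?del = "\<lambda>w. (remove1 c w, length (takeWhile (\<lambda>x. x \<noteq> c) w))"
  have validI: "valid d e (u @ c # v) \<longleftrightarrow>
    valid d e (u @ v) \<and> (if u = [] then d c = 0 else attack d e c (last u))"
    if "set (u @ v) = S - {c}" for u v
    using that top bot \<open>0 \<le> d c\<close> by (intro valid_insert) blast+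
  have "wsum d e q S = (\<Sum>(w, k)\<in>(SIGMA w:words d e (S - {c}). K w).
      q ^ ninv (attack d e) w * q ^ length (filter (attack d e c) (drop k w)))"
    unfolding wsum_def
  proof (rule sum.reindex_bij_witness[of _ ?ins ?del])
    fix w assume w: "w \<in> words d e S"
    then have "c \<in> set w" "distinct w" "set w = S" "valid d e w"
      using \<open>c \<in> S\<close> by (auto simp: words_def permutations_of_set_def)
    then obtain u v where uv: "w = u @ c # v" "c \<notin> set u" "c \<notin> set v"
      by (metis disjoint_insert(1) distinct_append list.simps(15) split_list distinct.simps(2))
    then have tw: "takeWhile (\<lambda>x. x \<noteq> c) w = u" "remove1 c w = u @ v"
      using takeWhile_insert[of c u v] by (auto simp: remove1_append)
    have Suv: "set (u @ v) = S - {c}" using uv \<open>set w = S\<close> by auto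
    show "?ins (?del w) = w" using uv tw by simp
    show "?del w \<in> (SIGMA w:words d e (S - {c}). K w)"
      using validI[OF Suv] Suv \<open>distinct w\<close> \<open>valid d e w\<close> uv tw
      by (auto simp: words_def permutations_of_set_def K_def)
    have "\<not> attack d e x c" if "x \<in> set u" for x
    proof -
      have "x \<in> S - {c}" using that unfolding Suv[symmetric] by simp
      from top[OF this] show ?thesis by (auto simp: attack_def)
    qed
    then have "ninv (attack d e) w = ninv (attack d e) (u @ v) + length (filter (attack d e c) v)"
      unfolding uv(1) by (rule ninv_insert)
    then show "(case ?del w of (w, k) \<Rightarrow> q ^ ninv (attack d e) w * q ^ length (filter (attack d e c) (drop k w)))
       = q ^ ninv (attack d e) w"
      unfolding prod.case tw using uv(1) by (simp add: power_add)
  next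
    fix p assume "p \<in> (SIGMA w:words d e (S - {c}). K w)"
    then obtain w k where p: "p = (w, k)" "w \<in> words d e (S - {c})" "k \<in> K w" by auto
    define u v where "u = take k w" and "v = drop k w"
    have w: "w = u @ v" "length u = k" using p by (auto simp: u_def v_def K_def)
    have Suv: "set (u @ v) = S - {c}" and "distinct (u @ v)" "valid d e (u @ v)"
      using p w by (auto simp: words_def permutations_of_set_def)
    moreover have cu: "c \<notin> set u" "c \<notin> set v" using Suv by auto
    moreover have "takeWhile (\<lambda>x. x \<noteq> c) (u @ c # v) = u" "remove1 c (u @ c # v) = u @ v"
      using cu takeWhile_insert[of c u v] by (auto simp: remove1_append)
    ultimately show "?del (?ins p) = p"
      using w p by simp
    show "?ins p \<in> words d e S"
      using validI[OF Suv] \<open>c \<in> S\<close> \<open>distinct (u @ v)\<close> \<open>valid d e (u @ v)\<close> Suv w p cu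
      by (auto simp: words_def permutations_of_set_def K_def)
  qed
  also have "\<dots> = (\<Sum>w\<in>words d e (S - {c}). \<Sum>k\<in>K w.
      q ^ ninv (attack d e) w * q ^ length (filter (attack d e c) (drop k w)))"
    using finW finK by (subst sum.Sigma) auto
  also have "\<dots> = (\<Sum>w\<in>words d e (S - {c}).
      q ^ ninv (attack d e) w * qint (card {x \<in> S. attack d e c x} + (if d c = 0 then 1 else 0)) q)"
  proof (rule sum.cong[OF refl])
    fix w assume "w \<in> words d e (S - {c})"
    then have "set w = S - {c}" "distinct w" by (auto simp: words_def permutations_of_set_def)
    moreover have "\<not> attack d e c c" by (simp add: attack_def)
    ultimately have "{x \<in> S. attack d e c x} = set (filter (attack d e c) w)" by auto
    then have "card {x \<in> S. attack d e c x} = length (filter (attack d e c) w)"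
      using \<open>distinct w\<close> by (metis distinct_card distinct_filter)
    then show "(\<Sum>k\<in>K w. q ^ ninv (attack d e) w * q ^ length (filter (attack d e c) (drop k w)))
      = q ^ ninv (attack d e) w * qint (card {x \<in> S. attack d e c x} + (if d c = 0 then 1 else 0)) q"
      using sum_insert_positions[where w = w and z = "d c = 0" and P = "attack d e c" and q = q]
      by (simp add: K_def flip: sum_distrib_left)
  qed
  finally show ?thesis
    by (simp add: wsum_def sum_distrib_left mult.commute)
qed

section \<open>Reversal symmetry of valid words\<close>

lemma valid_rev: "valid (\<lambda>x. - d x) (\<lambda>x. - e x) (rev w) \<longleftrightarrow> valid d e w"
proof -
  have *: "(\<lambda>x y. adj (\<lambda>x. - d x) (\<lambda>x. - e x) y x) = adj d e"
    by (auto simp: adj_def fun_eq_iff)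
  show ?thesis
    unfolding valid_def successively_rev * by (auto simp: hd_rev last_rev)
qed

lemma attack_mirror: "attack (\<lambda>x. - d x) (\<lambda>x. - e x) u v \<longleftrightarrow> attack d e v u"
  by (auto simp: attack_def)

text \<open>Lets \<open>wsum_remove_top\<close> also remove the largest car of the lowest diagonal
  when that diagonal is negative.\<close>

lemma wsum_mirror:
  fixes d :: "'a \<Rightarrow> int"
  shows "wsum (\<lambda>x. - d x) (\<lambda>x. - e x) q S = wsum d e q S"
  unfolding wsum_def
proof (rule sum.reindex_bij_witness[of _ rev rev])
  fix w :: "'a list"
  have "(\<lambda>x y. attack d e y x) = attack (\<lambda>x. - d x) (\<lambda>x. - e x)"
    by (auto simp: attack_def fun_eq_iff)
  then show "q ^ ninv (attack d e) (rev w) = q ^ ninv (attack (\<lambda>x. - d x) (\<lambda>x. - e x)) w"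
    by (simp add: ninv_rev)
next
  show "rev w \<in> words d e S" if "w \<in> words (\<lambda>x. - d x) (\<lambda>x. - e x) S" for w
    using that valid_rev[of d e "rev w"] by (auto simp: words_def permutations_of_set_def)
  show "rev w \<in> words (\<lambda>x. - d x) (\<lambda>x. - e x) S" if "w \<in> words d e S" for w
    using that by (auto simp: words_def permutations_of_set_def valid_rev)
qed auto

text \<open>The condition on diagonal \<open>0\<close> reflects that its cars are inserted first, before the cars of
  diagonal \<open>-1\<close>; the additional slot is the front of the word.\<close>
definition slots :: "('a \<Rightarrow> int) \<Rightarrow> ('a \<Rightarrow> int) \<Rightarrow> 'a set \<Rightarrow> 'a \<Rightarrow> nat" where
  "slots d e U c = card {x \<in> U. if d c < 0 then attack d e x c else attack d e c x \<and> (d c = 0 \<longrightarrow> d x = 0)}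
     + (if d c = 0 then 1 else 0)"

text \<open>Cars are removed one at a time: the largest of the lowest diagonal as long as that
  diagonal is negative, then the smallest of the highest diagonal. The closure hypotheses on
  \<open>S\<close> ensure that every car of \<open>U\<close> counted in the slots of the removed car
  is still present, so the factors can be counted in the fixed set \<open>U\<close>.\<close>

lemma wsum_eq_prod:
  fixes q :: "'b::comm_semiring_1"
  assumes "finite U" "inj_on e U" "S \<subseteq> U"
    and "\<And>c x. c \<in> S \<Longrightarrow> x \<in> U \<Longrightarrow> 0 \<le> d c \<Longrightarrow> d x = d c \<Longrightarrow> e c < e x \<Longrightarrow> x \<in> S"
    and "\<And>c x. c \<in> S \<Longrightarrow> x \<in> U \<Longrightarrow> 0 < d c \<Longrightarrow> d x = d c - 1 \<Longrightarrow> x \<in> S"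
    and "\<And>c x. c \<in> S \<Longrightarrow> x \<in> U \<Longrightarrow> d c < 0 \<Longrightarrow> d x = d c \<Longrightarrow> e x < e c \<Longrightarrow> x \<in> S"
    and "\<And>c x. c \<in> S \<Longrightarrow> x \<in> U \<Longrightarrow> d c < 0 \<Longrightarrow> d x = d c + 1 \<Longrightarrow> x \<in> S"
  shows "wsum d e q S = (\<Prod>c\<in>S. qint (slots d e U c) q)"
  using assms(3-)
proof (induction "card S" arbitrary: S)
  case 0
  then have "S = {}" using assms(1) finite_subset by (metis card_0_eq)
  then have "words d e S = {[]}" by (auto simp: words_def valid_def)
  then show ?case using \<open>S = {}\<close> by (simp add: wsum_def)
next
  case (Suc k)
  have finS: "finite S" using Suc.prems(1) assms(1) finite_subset by blast
  have ne: "S \<noteq> {}" using Suc.hyps(2) by auto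
  \<comment> \<open>Common to both kinds of removal: \<open>c\<close> is extremal, so the closure
    hypotheses never demand it for a remaining car and pass on to \<open>S - {c}\<close>.\<close>
  have step: ?case
    if c: "c \<in> S" and eq: "wsum d e q S = qint (slots d e U c) q * wsum d e q (S - {c})"
      and pos: "0 \<le> d c \<Longrightarrow> (\<And>x. x \<in> S - {c} \<Longrightarrow> d x < d c \<or> d x = d c \<and> e c < e x)"
      and neg: "d c < 0 \<Longrightarrow> (\<And>x. x \<in> S - {c} \<Longrightarrow> d x > d c \<or> d x = d c \<and> e x < e c)"
      and zero: "d c = 0 \<Longrightarrow> (\<And>x. x \<in> S \<Longrightarrow> 0 \<le> d x)" for c
  proof -
    have "wsum d e q (S - {c}) = (\<Prod>c\<in>S - {c}. qint (slots d e U c) q)"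
    proof (rule Suc.hyps(1))
      show "k = card (S - {c})" using Suc.hyps(2) c finS by simp
      show "S - {c} \<subseteq> U" using Suc.prems(1) by blast
      show "x \<in> S - {c}" if "b \<in> S - {c}" "x \<in> U" "0 \<le> d b" "d x = d b" "e b < e x" for b x
      proof -
        have "x \<in> S" using Suc.prems(2)[of b x] that by blast
        moreover have "b \<in> S" using that(1) by blast
        then have "x \<noteq> c" using that(3-) pos[OF _ that(1)] neg[OF _ that(1)] zero[of b]
          by (smt (verit))
        ultimately show ?thesis by simp
      qed
      show "x \<in> S - {c}" if "b \<in> S - {c}" "x \<in> U" "0 < d b" "d x = d b - 1" for b x
      proof -
        have "x \<in> S" using Suc.prems(3)[of b x] that by blast
        moreover have "b \<in> S" using that(1) by blast
        then have "x \<noteq> c" using that(3-) pos[OF _ that(1)] neg[OF _ that(1)] zero[of b]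
          by (smt (verit))
        ultimately show ?thesis by simp
      qed
      show "x \<in> S - {c}" if "b \<in> S - {c}" "x \<in> U" "d b < 0" "d x = d b" "e x < e b" for b x
      proof -
        have "x \<in> S" using Suc.prems(4)[of b x] that by blast
        moreover have "b \<in> S" using that(1) by blast
        then have "x \<noteq> c" using that(3-) pos[OF _ that(1)] neg[OF _ that(1)] zero[of b]
          by (smt (verit))
        ultimately show ?thesis by simp
      qed
      show "x \<in> S - {c}" if "b \<in> S - {c}" "x \<in> U" "d b < 0" "d x = d b + 1" for b x
      proof -
        have "x \<in> S" using Suc.prems(5)[of b x] that by blast
        moreover have "b \<in> S" using that(1) by blast
        then have "x \<noteq> c" using that(3-) pos[OF _ that(1)] neg[OF _ that(1)] zero[of b]
          by (smt (verit))
        ultimately show ?thesis by simp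
      qed
    qed
    then show ?thesis using eq c finS by (simp add: prod.remove)
  qed
  \<comment> \<open>A lexicographic choice, used once for \<open>d\<close> and \<open>e\<close> and
    once for their negatives.\<close>
  have pick: "\<exists>c\<in>S. \<forall>x\<in>S - {c}. g x < g c \<or> g x = g c \<and> h c < h x"
    if "inj_on h S" for g h :: "'a \<Rightarrow> int"
  proof -
    define M where "M = {x \<in> S. g x = Max (g ` S)}"
    have "finite M" using finS by (simp add: M_def)
    have "Max (g ` S) \<in> g ` S" using finS ne by simp
    then have "M \<noteq> {}" by (auto simp: M_def image_iff)
    then have "Min (h ` M) \<in> h ` M" using \<open>finite M\<close> by simp
    then obtain c where "Min (h ` M) = h c" "c \<in> M" by (rule imageE)
    then have c: "c \<in> M" "h c = Min (h ` M)" by simp_all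
    have "g x < g c \<or> g x = g c \<and> h c < h x" if x: "x \<in> S - {c}" for x
    proof (cases "x \<in> M")
      case True
      then have "h c \<le> h x" using \<open>finite M\<close> unfolding c(2) by (intro Min_le) auto
      moreover have "c \<in> S" using c(1) by (simp add: M_def)
      then have "h c \<noteq> h x" using \<open>inj_on h S\<close> x unfolding inj_on_def by blast
      moreover have "g x = g c" using True c(1) by (simp add: M_def)
      ultimately show ?thesis by linarith
    next
      case False
      then have "g x \<noteq> Max (g ` S)" using x by (simp add: M_def)
      moreover have "g x \<le> Max (g ` S)" using x finS by (intro Max_ge) auto
      moreover have "g c = Max (g ` S)" using c by (simp add: M_def)
      ultimately show ?thesis by linarith
    qed
    moreover have "c \<in> S" using c(1) by (simp add: M_def)
    ultimately show ?thesis by blast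
  qed
  have injS: "inj_on e S" using assms(2) Suc.prems(1) inj_on_subset by blast
  obtain c where c: "c \<in> S" "\<And>x. x \<in> S - {c} \<Longrightarrow> d x < d c \<or> d x = d c \<and> e c < e x"
    using pick[of e d] injS by blast
  have "inj_on (\<lambda>x. - e x) S" using injS by (auto simp: inj_on_def)
  from pick[OF this, of "\<lambda>x. - d x"]
  obtain b where b: "b \<in> S" "\<And>x. x \<in> S - {b} \<Longrightarrow> d x > d b \<or> d x = d b \<and> e x < e b"
    by force
  show ?case
  proof (cases "d b < 0")
    case True
    have "x \<in> S" if "x \<in> U" "attack d e x b" for x
      using that(2) Suc.prems(4)[OF b(1) that(1) True] Suc.prems(5)[OF b(1) that(1) True]
      unfolding attack_def by blast
    then have sl: "{x \<in> S. attack (\<lambda>x. - d x) (\<lambda>x. - e x) b x} = {x \<in> U. attack d e x b}"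
      using Suc.prems(1) by (auto simp: attack_mirror)
    have "- d x < - d b \<or> - d x = - d b \<and> - e b < - e x" if "x \<in> S - {b}" for x
      using b(2)[OF that] by simp
    \<comment> \<open>In the mirrored picture \<open>b\<close> is the smallest car of the highest
      diagonal, and that diagonal is positive.\<close>
    from wsum_remove_top[of S b "\<lambda>x. - d x" "\<lambda>x. - e x" q, OF finS b(1) _ this]
    have "wsum d e q S = qint (slots d e U b) q * wsum d e q (S - {b})"
      using True by (simp add: wsum_mirror sl slots_def)
    then show ?thesis
      using True b by (intro step[of b]) auto
  next
    case False
    \<comment> \<open>\<open>S\<close> has lost all negative diagonals by now. This is why
      \<open>slots\<close> does not count cars of diagonal -1 for a car in diagonal 0.\<close>
    have nonneg: "0 \<le> d x" if "x \<in> S" for x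
      using b(2)[of x] that False by fastforce
    have "x \<in> S" if "x \<in> U" "attack d e c x" "d c = 0 \<longrightarrow> d x = 0" for x
      using that(2,3) nonneg[OF c(1)] Suc.prems(2)[OF c(1) that(1)] Suc.prems(3)[OF c(1) that(1)]
      unfolding attack_def by (smt (verit))
    moreover have "d c = 0 \<longrightarrow> d x = 0" if "x \<in> S" "attack d e c x" for x
      using that(2) nonneg[OF that(1)] by (auto simp: attack_def)
    ultimately have sl: "{x \<in> S. attack d e c x} = {x \<in> U. attack d e c x \<and> (d c = 0 \<longrightarrow> d x = 0)}"
      using Suc.prems(1) by blast
    have "wsum d e q S = qint (slots d e U c) q * wsum d e q (S - {c})"
      unfolding wsum_remove_top[of S c d e q, OF finS c(1) nonneg[OF c(1)] c(2) nonneg, simplified] sl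
      using nonneg[OF c(1)] by (simp add: slots_def)
    then show ?thesis
      using nonneg[OF c(1)] nonneg by (intro step[OF c(1) _ c(2)]) simp_all
  qed
qed

section \<open>Preference functions as words\<close>

text \<open>The order of the cars by rows, from bottom to top.\<close>

definition before :: "('a::linorder \<Rightarrow> 'b::linorder) \<Rightarrow> 'a \<Rightarrow> 'a \<Rightarrow> bool" where
  "before f a b \<longleftrightarrow> f a < f b \<or> f a = f b \<and> a < b"

lemma transp_before: "transp (before f)"
  by (auto simp: transp_def before_def)

lemma successively_nth:
  "successively P xs \<longleftrightarrow> (\<forall>i. Suc i < length xs \<longrightarrow> P (xs ! i) (xs ! Suc i))"
proof (induction xs rule: induct_list012)
  case (3 x y zs)
  have "(\<forall>i. R i) \<longleftrightarrow> R 0 \<and> (\<forall>i. R (Suc i))" for R :: "nat \<Rightarrow> bool"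
    by (metis not0_implies_Suc)
  from this[of "\<lambda>i. Suc i < length (x # y # zs) \<longrightarrow> P ((x # y # zs) ! i) ((x # y # zs) ! Suc i)"]
  show ?case using 3 by simp
qed auto

lemma before_asym: "before f a b \<Longrightarrow> \<not> before f b a"
  by (auto simp: before_def)

lemma ninv_eq_card:
  assumes "sorted_wrt B w" "distinct w" and asym: "\<And>a b. B a b \<Longrightarrow> \<not> B b a"
  shows "ninv P w = card {(a, b). a \<in> set w \<and> b \<in> set w \<and> P a b \<and> B a b}"
  using assms(1,2)
proof (induction w)
  case (Cons x xs)
  let ?Q = "{(a, b). a \<in> set xs \<and> b \<in> set xs \<and> P a b \<and> B a b}"
  let ?R = "Pair x ` set (filter (P x) xs)"
  have *: "{(a, b). a \<in> set (x # xs) \<and> b \<in> set (x # xs) \<and> P a b \<and> B a b} = ?R \<union> ?Q"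
    using Cons.prems asym by auto
  have fin: "finite ?Q" by (rule finite_subset[of _ "set xs \<times> set xs"]) auto
  have "?R \<inter> ?Q = {}" using Cons.prems by auto
  then have "card (?R \<union> ?Q) = card ?R + card ?Q" using fin by (intro card_Un_disjoint) auto
  also have "card ?R = length (filter (P x) xs)"
    using Cons.prems by (subst card_image) (auto simp: inj_on_def distinct_card simp del: set_filter)
  finally show ?case using Cons unfolding * by simp
qed simp

lemma rowy_eq: "rowy n f c = int (card {x \<in> {1..n}. before f x c})"
proof -
  have "{x \<in> {1..n}. before f x c} = {x \<in> {1..n}. f x < f c} \<union> {x \<in> {1..n}. f x = f c \<and> x < c}"
    by (auto simp: before_def)
  moreover have "card ({x \<in> {1..n}. f x < f c} \<union> {x \<in> {1..n}. f x = f c \<and> x < c})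
    = card {x \<in> {1..n}. f x < f c} + card {x \<in> {1..n}. f x = f c \<and> x < c}"
    by (rule card_Un_disjoint) auto
  ultimately show ?thesis by (simp add: rowy_def)
qed

lemma rowy_nth:
  assumes w: "sorted_wrt (before f) w" "distinct w" "set w = {1..n}" and i: "i < length w"
  shows "rowy n f (w ! i) = int i"
proof -
  have "{x \<in> {1..n}. before f x (w ! i)} = (!) w ` {..<i}"
  proof (intro equalityI subsetI)
    fix x assume x: "x \<in> {x \<in> {1..n}. before f x (w ! i)}"
    then obtain j where j: "j < length w" "x = w ! j"
      using w(3) by (metis (mono_tags, lifting) in_set_conv_nth mem_Collect_eq)
    then have "before f (w ! j) (w ! i)" using x by simp
    then have "\<not> i < j" "i \<noteq> j"
      using before_asym sorted_wrt_nth_less[OF w(1)] j(1) by blast+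
    then show "x \<in> (!) w ` {..<i}" using j by auto
  next
    fix x assume "x \<in> (!) w ` {..<i}"
    then show "x \<in> {x \<in> {1..n}. before f x (w ! i)}"
      using i w(3) sorted_wrt_nth_less[OF w(1)] nth_mem by fastforce
  qed
  moreover have "inj_on ((!) w) {..<i}"
    using i w(2) by (auto simp: inj_on_def nth_eq_iff_index_eq)
  ultimately show ?thesis by (simp add: rowy_eq card_image)
qed

lemma sorted_before_unique:
  fixes f :: "nat \<Rightarrow> nat"
  assumes w: "sorted_wrt (before f) w" "distinct w" "set w = {1..n}"
    and v: "sorted_wrt (before f) v" "distinct v" "set v = {1..n}"
  shows "v = w"
proof (rule nth_equalityI)
  show len: "length v = length w" using w v by (metis distinct_card)
  fix i assume i: "i < length v"
  then have "v ! i \<in> set w" using v w nth_mem by blast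
  then obtain j where j: "j < length w" "v ! i = w ! j" by (metis in_set_conv_nth)
  then have "i = j" using rowy_nth[OF w j(1)] rowy_nth[OF v i] by simp
  then show "v ! i = w ! i" using j by simp
qed

text \<open>Labels are at most \<open>n\<close>, so this key sorts by column first and by label
  second.\<close>

definition readword :: "nat \<Rightarrow> (nat \<Rightarrow> nat) \<Rightarrow> nat list" where
  "readword n f = sort_key (\<lambda>c. f c * (n + 1) + c) [1..<n+1]"

lemma length_readword [simp]: "length (readword n f) = n"
  by (simp add: readword_def del: upt_Suc)

lemma readword:
  fixes f :: "nat \<Rightarrow> nat"
  shows "sorted_wrt (before f) (readword n f)" "distinct (readword n f)" "set (readword n f) = {1..n}"
proof -
  let ?k = "\<lambda>c. f c * (n + 1) + c"
  show d: "distinct (readword n f)" and s: "set (readword n f) = {1..n}"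
    by (auto simp: readword_def)
  have "sorted_wrt (\<lambda>x y. ?k x \<le> ?k y) (readword n f)"
    using sorted_sort_key[of ?k "[1..<n+1]"] by (simp add: readword_def sorted_map)
  then have "sorted_wrt (\<lambda>x y. ?k x \<le> ?k y \<and> x \<noteq> y) (readword n f)"
    using d by (auto simp: sorted_wrt_iff_nth_less nth_eq_iff_index_eq)
  then show "sorted_wrt (before f) (readword n f)"
  proof (rule sorted_wrt_mono_rel[rotated])
    fix x y assume xy: "x \<in> set (readword n f)" "y \<in> set (readword n f)" "?k x \<le> ?k y \<and> x \<noteq> y"
    have "\<not> f y < f x"
    proof
      assume "f y < f x"
      then have "(f y + 1) * (n + 1) \<le> f x * (n + 1)" by (intro mult_le_mono1) simp
      moreover have "y \<le> n" using xy s by auto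
      ultimately show False using xy by simp
    qed
    then show "before f x y" using xy by (auto simp: before_def)
  qed
qed

definition pos :: "'a list \<Rightarrow> 'a \<Rightarrow> nat" where
  "pos w c = length (takeWhile (\<lambda>x. x \<noteq> c) w)"

lemma pos_nth: "distinct w \<Longrightarrow> i < length w \<Longrightarrow> pos w (w ! i) = i"
  unfolding pos_def by (subst takeWhile_eq_take_P_nth[of i]) (auto simp: nth_eq_iff_index_eq)

text \<open>The inverse of \<open>readword\<close>: row \<open>i\<close> meets diagonal \<open>d\<close> in column \<open>i - d\<close>,
  which is shifted by one because \<open>f\<close> numbers the columns from \<open>1\<close>.\<close>
definition wordpref :: "nat \<Rightarrow> (nat \<Rightarrow> int) \<Rightarrow> nat list \<Rightarrow> nat \<Rightarrow> nat" where
  "wordpref n d w = (\<lambda>c\<in>{1..n}. nat (int (pos w c) - d c + 1))"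

text \<open>By \<open>adj\<close> the columns computed from positions and \<open>d\<close> weakly
  increase along the word, with increasing labels at ties. Hence the word is the row order of the
  resulting function, the row of a car is its position, and its diagonal comes out as
  \<open>d\<close>.\<close>

lemma wordpref:
  assumes "w \<in> words d int {1..n}"
  shows "wordpref n d w \<in> {1..n} \<rightarrow>\<^sub>E {1..n}"
    and "sorted_wrt (before (wordpref n d w)) w"
    and "\<And>c. c \<in> {1..n} \<Longrightarrow> diag n (wordpref n d w) c = d c"
proof -
  have w: "set w = {1..n}" "distinct w" "valid d int w"
    using assms by (auto simp: words_def permutations_of_set_def)
  have len: "length w = n" using w(1,2) distinct_card by fastforce
  \<comment> \<open>The column before truncation by \<open>nat\<close>; \<open>rngc\<close> shows
    that the truncation loses nothing.\<close>
  define g where "g c = int (pos w c) - d c + 1" for c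
  have "before g (w ! i) (w ! Suc i)" if "Suc i < length w" for i
  proof -
    have "adj d int (w ! i) (w ! Suc i)"
      using w(3) that by (auto simp: valid_def successively_nth)
    then show ?thesis
      using that pos_nth[OF w(2), of i] pos_nth[OF w(2), of "Suc i"]
      by (auto simp: before_def g_def adj_def)
  qed
  then have sg: "sorted_wrt (before g) w"
    by (simp add: transp_before successively_nth flip: successively_conv_sorted_wrt)
  \<comment> \<open>Columns weakly increase along the word, so only its ends matter. There the
    column is \<open>1 - d\<close> and \<open>n - d\<close>, with the signs of \<open>d\<close>
    given by \<open>valid\<close>.\<close>
  have rng: "1 \<le> g (w ! i) \<and> g (w ! i) \<le> int n" if i: "i < n" for i
  proof -
    have "w \<noteq> []" using i len by auto
    then have "d (w ! 0) \<le> 0" "0 \<le> d (w ! (n - 1))"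
      using w(3) len by (auto simp: valid_def hd_conv_nth last_conv_nth)
    then have "1 \<le> g (w ! 0)" "g (w ! (n - 1)) \<le> int n"
      using i len pos_nth[OF w(2), of 0] pos_nth[OF w(2), of "n - 1"] by (auto simp: g_def)
    moreover have "g (w ! 0) \<le> g (w ! i)"
      using sorted_wrt_nth_less[OF sg, of 0 i] i len by (cases "i = 0") (auto simp: before_def)
    moreover have "g (w ! i) \<le> g (w ! (n - 1))"
    proof (cases "i = n - 1")
      case False
      then have "i < n - 1" "n - 1 < length w" using i len by linarith+
      from sorted_wrt_nth_less[OF sg this] show ?thesis by (auto simp: before_def)
    qed simp
    ultimately show ?thesis by linarith
  qed
  have rngc: "1 \<le> g c \<and> g c \<le> int n" if "c \<in> {1..n}" for c
    using that rng w(1) len by (metis in_set_conv_nth)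
  have f: "wordpref n d w c = nat (g c)" if "c \<in> {1..n}" for c
    using that by (simp add: wordpref_def g_def)
  have "wordpref n d w c \<in> {1..n}" if "c \<in> {1..n}" for c
    using f[OF that] rngc[OF that] by auto
  then show "wordpref n d w \<in> {1..n} \<rightarrow>\<^sub>E {1..n}"
    by (intro PiE_I) (auto simp: wordpref_def)
  show sf: "sorted_wrt (before (wordpref n d w)) w"
    using sg
  proof (rule sorted_wrt_mono_rel[rotated])
    fix x y assume "x \<in> set w" "y \<in> set w" "before g x y"
    then show "before (wordpref n d w) x y"
      using f[of x] f[of y] rngc[of x] rngc[of y] w(1) by (auto simp: before_def)
  qed
  show "diag n (wordpref n d w) c = d c" if c: "c \<in> {1..n}" for c
  proof -
    obtain i where i: "i < length w" "c = w ! i" using c w(1) by (metis in_set_conv_nth)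
    then have "rowy n (wordpref n d w) c = int i" using rowy_nth[OF sf w(2,1)] by simp
    moreover have "int (wordpref n d w c) = int i - d c + 1"
      using f[OF c] rngc[OF c] pos_nth[OF w(2) i(1)] i(2) by (simp add: g_def)
    ultimately show ?thesis by (simp add: diag_def colx_def)
  qed
qed

lemma diag_readword:
  assumes "i < n"
  shows "int (f (readword n f ! i)) = int i - diag n f (readword n f ! i) + 1"
proof -
  show ?thesis
    using rowy_nth[OF readword, of i] assms by (simp add: diag_def colx_def)
qed

text \<open>Going up one row never decreases the column, so the diagonal rises by at most one, and
  by exactly one only inside a column, where labels grow. Columns between 1 and \<open>n\<close>
  give the conditions at both ends.\<close>

lemma readword_in_words:
  assumes f: "f \<in> {1..n} \<rightarrow>\<^sub>E {1..n}"
  shows "readword n f \<in> words (diag n f) int {1..n}"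
proof -
  let ?w = "readword n f"
  note rw = readword[where f = f and n = n]
  have len: "length ?w = n" by simp
  have rng: "1 \<le> f (?w ! i)" "f (?w ! i) \<le> n" if "i < n" for i
  proof -
    have "?w ! i \<in> {1..n}" using nth_mem[of i ?w] that rw(3) len by simp
    then have "f (?w ! i) \<in> {1..n}" using f by (rule PiE_mem[rotated])
    then show "1 \<le> f (?w ! i)" "f (?w ! i) \<le> n" by auto
  qed
  have "adj (diag n f) int (?w ! i) (?w ! Suc i)" if "Suc i < n" for i
  proof -
    have "before f (?w ! i) (?w ! Suc i)"
      using sorted_wrt_nth_less[OF rw(1), of i "Suc i"] that len by simp
    then show ?thesis
      using diag_readword[of i n f] diag_readword[of "Suc i" n f] that
      by (auto simp: before_def adj_def)
  qed
  moreover have "diag n f (hd ?w) \<le> 0 \<and> 0 \<le> diag n f (last ?w)" if "?w \<noteq> []"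
  proof -
    have n: "0 < n" using that len by (metis length_greater_0_conv)
    then show ?thesis
      using diag_readword[of 0 n f] diag_readword[of "n - 1" n f] rng(1)[of 0] rng(2)[of "n - 1"]
      by (simp add: hd_conv_nth last_conv_nth that len)
  qed
  ultimately show ?thesis
    using rw by (simp add: words_def permutations_of_set_def valid_def successively_nth len)
qed

lemma wordpref_readword:
  assumes f: "f \<in> {1..n} \<rightarrow>\<^sub>E {1..n}" and d: "\<And>c. c \<in> {1..n} \<Longrightarrow> diag n f c = d c"
  shows "wordpref n d (readword n f) = f"
proof (rule PiE_ext[of _ "{1..n}" "\<lambda>_. UNIV"])
  show "wordpref n d (readword n f) \<in> {1..n} \<rightarrow>\<^sub>E UNIV" by (auto simp: wordpref_def)
  show "f \<in> {1..n} \<rightarrow>\<^sub>E UNIV" using f by (auto simp: PiE_iff)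
  fix c assume c: "c \<in> {1..n}"
  then obtain i where i: "i < length (readword n f)" "c = readword n f ! i"
    using readword(3) by (metis in_set_conv_nth)
  then have "i < n" by simp
  then show "wordpref n d (readword n f) c = f c"
    using c d[OF c] i pos_nth[OF readword(2) i(1)] diag_readword[of i n f]
    by (simp add: wordpref_def)
qed

lemma dinv_readword:
  "dinv n f = ninv (attack (diag n f) int) (readword n f) + card {c \<in> {1..n}. diag n f c < 0}"
proof -
  note rw = readword[where f = f and n = n]
  let ?d = "diag n f"
  let ?A = "{(a, b). a \<in> {1..n} \<and> b \<in> {1..n} \<and> ?d a = ?d b \<and> colx f a < colx f b \<and> a < b}"
  let ?B = "{(a, b). a \<in> {1..n} \<and> b \<in> {1..n} \<and> b < a \<and> ?d a = ?d b + 1 \<and> colx f a < colx f b}"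
  \<comment> \<open>Rules out attacks inside a column: there the earlier car is in a lower row,
    hence in a lower diagonal, whereas an attacking car is never in a lower diagonal than its
    target.\<close>
  have row: "rowy n f a < rowy n f b" if "a \<in> {1..n}" "before f a b" for a b
  proof -
    have "{x \<in> {1..n}. before f x a} \<subset> {x \<in> {1..n}. before f x b}"
      using that by (auto simp: before_def)
    then show ?thesis by (simp add: rowy_eq psubset_card_mono)
  qed
  have "{(a, b). a \<in> set (readword n f) \<and> b \<in> set (readword n f) \<and> attack ?d int a b \<and> before f a b}
    = ?A \<union> ?B"
  proof -
    have "attack ?d int a b \<and> before f a b \<longleftrightarrow> (?d a = ?d b \<and> colx f a < colx f b \<and> a < b)
       \<or> (b < a \<and> ?d a = ?d b + 1 \<and> colx f a < colx f b)" if "a \<in> {1..n}" for a b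
      using row[OF that, of b] by (auto simp: attack_def before_def colx_def diag_def)
    then show ?thesis unfolding rw(3) by blast
  qed
  moreover have "card (?A \<union> ?B) = card ?A + card ?B"
  proof (rule card_Un_disjoint)
    show "finite ?A" "finite ?B"
      by (rule finite_subset[of _ "{1..n} \<times> {1..n}"]; auto)+
  qed auto
  moreover have "ninv (attack ?d int) (readword n f) = card {(a, b). a \<in> set (readword n f) \<and>
      b \<in> set (readword n f) \<and> attack ?d int a b \<and> before f a b}"
    using rw(1,2) before_asym by (rule ninv_eq_card)
  ultimately show ?thesis
    by (simp only: dinv_def)
qed

text \<open>\<open>readword\<close> and \<open>wordpref n d\<close> are mutually inverse here. The
  power in front is the third term of \<open>dinv\<close>, which is constant once the diagonals are
  fixed.\<close>

lemma sum_pref_eq_wsum: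
  fixes q :: "'b::comm_semiring_1"
  shows "(\<Sum>f | f \<in> {1..n} \<rightarrow>\<^sub>E {1..n} \<and> (\<forall>c\<in>{1..n}. diag n f c = d c). q ^ dinv n f)
    = q ^ card {c \<in> {1..n}. d c < 0} * wsum d int q {1..n}"
  unfolding wsum_def sum_distrib_left
proof (rule sum.reindex_bij_witness[of _ "wordpref n d" "readword n"])
  \<comment> \<open>\<open>diag n f\<close> and \<open>d\<close> agree only on the cars, so
    exchanging them requires that all letters are cars.\<close>
  have cong: "words d int {1..n} = words (diag n f) int {1..n}"
    "ninv (attack d int) (readword n f) = ninv (attack (diag n f) int) (readword n f)"
    if "\<forall>c\<in>{1..n}. diag n f c = d c" for f
  proof -
    have "valid d int w = valid (diag n f) int w" if w: "set w = {1..n}" for w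
    proof -
      have "successively (adj d int) w = successively (adj (diag n f) int) w"
        using \<open>\<forall>c\<in>{1..n}. diag n f c = d c\<close> w
        by (intro successively_cong) (auto simp: adj_def)
      moreover have "w \<noteq> [] \<Longrightarrow> hd w \<in> {1..n} \<and> last w \<in> {1..n}" using w by auto
      ultimately show ?thesis
        using \<open>\<forall>c\<in>{1..n}. diag n f c = d c\<close> by (auto simp: valid_def)
    qed
    then show "words d int {1..n} = words (diag n f) int {1..n}"
      by (auto simp: words_def permutations_of_set_def)
    have "ninv (attack d int) w = ninv (attack (diag n f) int) w" if "set w \<subseteq> {1..n}" for w
      using that
    proof (induction w)
      case (Cons x xs)
      have "filter (attack d int x) xs = filter (attack (diag n f) int x) xs"
        using \<open>\<forall>c\<in>{1..n}. diag n f c = d c\<close> Cons.prems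
        by (intro filter_cong) (auto simp: attack_def)
      then show ?case using Cons by simp
    qed simp
    then show "ninv (attack d int) (readword n f) = ninv (attack (diag n f) int) (readword n f)"
      using readword(3) by blast
  qed
  fix f assume "f \<in> {f. f \<in> {1..n} \<rightarrow>\<^sub>E {1..n} \<and> (\<forall>c\<in>{1..n}. diag n f c = d c)}"
  then have f: "f \<in> {1..n} \<rightarrow>\<^sub>E {1..n}" "\<forall>c\<in>{1..n}. diag n f c = d c" by auto
  show "wordpref n d (readword n f) = f" using f by (intro wordpref_readword) auto
  show "readword n f \<in> words d int {1..n}" using readword_in_words[OF f(1)] cong(1)[OF f(2)] by simp
  have "{c \<in> {1..n}. diag n f c < 0} = {c \<in> {1..n}. d c < 0}" using f by auto
  then show "q ^ card {c \<in> {1..n}. d c < 0} * q ^ ninv (attack d int) (readword n f) = q ^ dinv n f"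
    unfolding dinv_readword cong(2)[OF f(2)] by (simp add: power_add mult.commute)
next
  fix w assume w: "w \<in> words d int {1..n}"
  show "wordpref n d w \<in> {f. f \<in> {1..n} \<rightarrow>\<^sub>E {1..n} \<and> (\<forall>c\<in>{1..n}. diag n f c = d c)}"
    using wordpref[OF w] by blast
  show "readword n (wordpref n d w) = w"
    using w wordpref(2)[OF w] readword[where f = "wordpref n d w" and n = n]
    by (intro sorted_before_unique) (auto simp: words_def permutations_of_set_def)
qed

section \<open>Runs and the major index\<close>

text \<open>The walk passes each level equally often downwards and upwards, up to its net change
  from \<open>card A\<close> to \<open>card B\<close>, which the two initial segments compensate.
  The induction builds the union from its largest element downwards.\<close>

lemma crossing_multiset:
  fixes A B :: "nat set"
  assumes "finite A" "finite B" "A \<inter> B = {}"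
  defines "g \<equiv> \<lambda>A B c. card {x \<in> A. c < x} + card {y \<in> B. y < c}"
  shows "image_mset (g A B) (mset_set A) + mset_set {..<card B}
       = image_mset (g A B) (mset_set B) + mset_set {..<card A}"
proof -
  have lt: "mset_set {..<Suc m} = add_mset 0 (image_mset Suc (mset_set {..<m}))" for m
    by (simp add: lessThan_Suc_eq_insert_0 image_mset_mset_set)
  have "\<And>A B. U = A \<union> B \<Longrightarrow> A \<inter> B = {} \<Longrightarrow>
      image_mset (g A B) (mset_set A) + mset_set {..<card B}
       = image_mset (g A B) (mset_set B) + mset_set {..<card A}" if "finite U" for U
    using that
  proof (induction U rule: finite_linorder_min_induct)
    case empty
    then show ?case by simp
  next
    case (insert b U)
    have fin: "finite A" "finite B" using insert.hyps(1) insert.prems(1)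
      by (metis finite_Un finite_insert)+
    have bU: "b \<notin> U" using insert.hyps(2) by blast
    consider "b \<in> A" | "b \<in> B" using insert.prems(1) by blast
    then show ?case
    proof cases
      \<comment> \<open>A new smallest element in \<open>A\<close> leaves all other values unchanged
        and has itself the value \<open>card A'\<close>.\<close>
      case 1
      define A' where "A' = A - {b}"
      have A: "A = insert b A'" "b \<notin> A'" "finite A'" using 1 fin by (auto simp: A'_def)
      have U: "U = A' \<union> B" using insert.prems bU A 1 by auto
      have IH: "image_mset (g A' B) (mset_set A') + mset_set {..<card B}
       = image_mset (g A' B) (mset_set B) + mset_set {..<card A'}"
        using insert.IH[OF U] insert.prems A by auto
      have less: "b < x" if "x \<in> A' \<union> B" for x using insert.hyps(2) U that by auto
      have "g A B x = g A' B x" if "x \<in> A' \<union> B" for x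
      proof -
        have "{y \<in> A. x < y} = {y \<in> A'. x < y}" using A less[OF that] by auto
        then show ?thesis by (simp add: g_def)
      qed
      then have 2: "image_mset (g A B) (mset_set A') = image_mset (g A' B) (mset_set A')"
         "image_mset (g A B) (mset_set B) = image_mset (g A' B) (mset_set B)"
        using A fin by (auto intro!: image_mset_cong)
      have "{x \<in> A. b < x} = A'" "{y \<in> B. y < b} = {}" using less A by (auto dest: less_asym)
      then have "g A B b = card A'" unfolding g_def by simp
      then show ?thesis using A 2 IH by (simp add: lessThan_Suc)
    next
      \<comment> \<open>A new smallest element in \<open>B\<close> raises all other values by one
        and has itself the value \<open>card A\<close>. Raising the induction hypothesis by one
        frees the level 0, which \<open>lt\<close> supplies on both sides.\<close>
      case 2
      define B' where "B' = B - {b}"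
      have B: "B = insert b B'" "b \<notin> B'" "finite B'" using 2 fin by (auto simp: B'_def)
      have U: "U = A \<union> B'" using insert.prems bU B 2 by auto
      have IH: "image_mset (g A B') (mset_set A) + mset_set {..<card B'}
       = image_mset (g A B') (mset_set B') + mset_set {..<card A}"
        using insert.IH[OF U] insert.prems B by auto
      have less: "b < x" if "x \<in> A \<union> B'" for x using insert.hyps(2) U that by auto
      have "g A B x = Suc (g A B' x)" if "x \<in> A \<union> B'" for x
      proof -
        have "{y \<in> B. y < x} = insert b {y \<in> B'. y < x}" using B less[OF that] by auto
        then show ?thesis using B by (simp add: g_def)
      qed
      then have 3: "image_mset (g A B) (mset_set A) = image_mset Suc (image_mset (g A B') (mset_set A))"
         "image_mset (g A B) (mset_set B') = image_mset Suc (image_mset (g A B') (mset_set B'))"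
        using B fin by (auto simp: multiset.map_comp intro!: image_mset_cong)
      have "{x \<in> A. b < x} = A" "{y \<in> B. y < b} = {}" using less B by (auto dest: less_asym)
      then have 4: "g A B b = card A" unfolding g_def by simp
      have cB: "card B = Suc (card B')" using B by simp
      have "image_mset (g A B) (mset_set A) + mset_set {..<card B}
        = add_mset 0 (image_mset Suc (image_mset (g A B') (mset_set A) + mset_set {..<card B'}))"
        using cB by (simp add: 3 lt)
      also have "\<dots> = image_mset (g A B) (mset_set B') + mset_set {..<Suc (card A)}"
        unfolding IH by (simp add: 3 lt)
      also have "\<dots> = image_mset (g A B) (mset_set B) + mset_set {..<card A}"
        using B cB 4 by (simp add: lessThan_Suc)
      finally show ?thesis .
    qed
  qed
  from this[of "A \<union> B" A B] show ?thesis using assms(1-3) by simp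
qed

section \<open>Decomposition of a list into its runs\<close>

lemma runs_Cons:
  "xs \<noteq> [] \<Longrightarrow> runs (x # xs) =
    (if x < hd xs then (x # hd (runs xs)) # tl (runs xs) else [x] # runs xs)"
  by (cases xs) (simp_all add: Let_def)

lemma runs_ne_Nil: "xs \<noteq> [] \<Longrightarrow> runs xs \<noteq> []"
  by (induction xs rule: runs.induct) (auto simp: Let_def)

lemma Nil_notin_runs: "[] \<notin> set (runs xs)"
proof (induction xs)
  case (Cons x xs)
  then show ?case
    by (cases "xs = []") (auto simp: runs_Cons dest: list.set_sel(2)[OF runs_ne_Nil])
qed simp

lemma concat_runs [simp]: "concat (runs xs) = xs"
proof (induction xs)
  case (Cons x xs)
  then show ?case
    by (cases "xs = []"; cases "runs xs") (auto simp: runs_Cons runs_ne_Nil)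
qed simp

lemma hd_hd_runs: "xs \<noteq> [] \<Longrightarrow> hd (hd (runs xs)) = hd xs"
  by (cases xs; cases "tl xs = []") (auto simp: runs_Cons)

lemma strict_sorted_runs: "r \<in> set (runs xs) \<Longrightarrow> sorted_wrt (<) r"
proof (induction xs arbitrary: r)
  case (Cons x xs)
  show ?case
  proof (cases "xs = []")
    case False
    have h: "hd (runs xs) \<in> set (runs xs)" using False runs_ne_Nil by simp
    then obtain y ys where y: "hd (runs xs) = y # ys" using Nil_notin_runs by (metis list.exhaust)
    then have "y = hd xs" using hd_hd_runs[OF False] by simp
    then have "x < hd xs \<Longrightarrow> sorted_wrt (<) (x # hd (runs xs))"
      using Cons.IH[OF h] y by auto
    then show ?thesis
      using Cons False list.set_sel(2)[OF runs_ne_Nil[OF False]]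
      by (auto simp: runs_Cons split: if_splits)
  qed (use Cons in auto)
qed simp

text \<open>Uniqueness of the run decomposition; it serves to recognise the diagonals as
  runs.\<close>

lemma runs_concat:
  assumes "\<And>r. r \<in> set rs \<Longrightarrow> r \<noteq> [] \<and> sorted_wrt (<) r"
    and "successively (\<lambda>r s. \<not> last r < hd s) rs"
  shows "runs (concat rs) = rs"
  using assms
proof (induction rs)
  case (Cons r rs)
  have IH: "runs (concat rs) = rs" using Cons by (cases rs) auto
  have "r \<noteq> []" "sorted_wrt (<) r" using Cons.prems(1) by auto
  moreover have "rs = [] \<or> \<not> last r < hd (concat rs)"
    using Cons.prems by (cases rs) auto
  ultimately have "runs (r @ concat rs) = r # rs"
  proof (induction r)
    case (Cons x r)
    show ?case
    proof (cases "r = []")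
      case True
      then show ?thesis using Cons.prems IH
        by (cases "concat rs = []") (auto simp: runs_Cons)
    next
      case False
      then have "x < hd r" using Cons.prems by auto
      then show ?thesis using Cons False by (auto simp: runs_Cons)
    qed
  qed simp
  then show ?case by simp
qed simp

section \<open>The major index in terms of runs\<close>

fun wlen :: "'a list list \<Rightarrow> nat" where
  "wlen [] = 0"
| "wlen (r # rs) = length rs * length r + wlen rs"

definition dset :: "nat list \<Rightarrow> nat set" where
  "dset \<tau> = {i. 1 \<le> i \<and> i < length \<tau> \<and> \<tau> ! (i - 1) > \<tau> ! i}"

lemma finite_dset: "finite (dset xs)"
  by (rule finite_subset[of _ "{..length xs}"]) (auto simp: dset_def)

lemma dset_Cons: "dset (x # y # xs) = Suc ` dset (y # xs) \<union> (if y < x then {1} else {})"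
proof (intro set_eqI)
  fix i
  show "i \<in> dset (x # y # xs) \<longleftrightarrow> i \<in> Suc ` dset (y # xs) \<union> (if y < x then {1} else {})"
  proof (cases i)
    case (Suc j)
    then show ?thesis by (cases j) (auto simp: dset_def)
  qed (auto simp: dset_def)
qed

lemma maj_conv_dset: "maj xs = \<Sum>(dset xs)"
  by (simp add: maj_def dset_def)

text \<open>A descent at position \<open>i\<close> contributes one for each of the \<open>i\<close>
  letters up to it, so \<open>maj\<close> weights a letter by the number of later runs. Prepending a
  letter shifts every descent by one, which is why the induction also counts descents.\<close>

lemma maj_eq_wlen:
  assumes "distinct xs" "xs \<noteq> []"
  shows "maj xs = wlen (runs xs) \<and> length (runs xs) = Suc (card (dset xs))"
  using assms
proof (induction xs rule: induct_list012)
  case (2 x)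
  have "dset [x] = {}" by (auto simp: dset_def)
  then show ?case by (simp add: maj_conv_dset)
next
  case (3 x y xs)
  have IH: "maj (y # xs) = wlen (runs (y # xs))" "length (runs (y # xs)) = Suc (card (dset (y # xs)))"
    using 3 by auto
  obtain r rs where r: "runs (y # xs) = r # rs" using runs_ne_Nil[of "y # xs"] by (cases "runs (y # xs)") auto
  have s: "\<Sum>(Suc ` dset (y # xs)) = maj (y # xs) + card (dset (y # xs))"
    by (simp add: sum.reindex sum_Suc maj_conv_dset)
  have z: "1 \<notin> Suc ` dset (y # xs)" by (auto simp: dset_def)
  show ?case
  proof (cases "x < y")
    case True
    then show ?thesis using IH s r by (simp add: maj_conv_dset dset_Cons runs_Cons card_image)
  next
    case False
    then have "y < x" using 3 by auto
    then have "dset (x # y # xs) = insert 1 (Suc ` dset (y # xs))" by (simp add: dset_Cons)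
    then show ?thesis using False IH s z finite_dset[of "y # xs"]
      by (simp add: maj_conv_dset runs_Cons card_image)
  qed
qed simp

lemma wlen_eq: "wlen rs = (\<Sum>j<length rs. j * length (rev rs ! j))"
  by (induction rs) (simp_all add: nth_append)

section \<open>Diagonals are runs\<close>

lemma rruns_Nil_notin: "[] \<notin> set (rruns \<tau>)"
  by (simp add: rruns_def Nil_notin_runs)

lemma concat_rev_rruns: "concat (rev (rruns \<tau>)) = \<tau>"
  by (simp add: rruns_def)

lemma UN_rruns: "(\<Union>j<length (rruns \<tau>). set (rruns \<tau> ! j)) = set \<tau>"
proof -
  have "set \<tau> = \<Union> (set ` set (rruns \<tau>))"
    using concat_rev_rruns[of \<tau>] by (metis set_concat set_rev)
  then show ?thesis by (auto simp: set_conv_nth)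
qed

lemma sorted_rruns: "j < length (rruns \<tau>) \<Longrightarrow> sorted_wrt (<) (rruns \<tau> ! j)"
  using strict_sorted_runs[of "rruns \<tau> ! j" \<tau>] nth_mem[of j "rruns \<tau>"]
  by (simp add: rruns_def)

lemma distinct_rruns: "j < length (rruns \<tau>) \<Longrightarrow> distinct (rruns \<tau> ! j)"
  using sorted_rruns[of j \<tau>] by (simp add: strict_sorted_iff)

lemma card_rruns: "j < length (rruns \<tau>) \<Longrightarrow> card (set (rruns \<tau> ! j)) = rho \<tau> j"
  using distinct_card[OF distinct_rruns] by (simp add: rho_def)

lemma rruns_disjoint:
  assumes "distinct \<tau>" "i < length (rruns \<tau>)" "j < length (rruns \<tau>)" "i \<noteq> j"
  shows "set (rruns \<tau> ! i) \<inter> set (rruns \<tau> ! j) = {}"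
proof -
  have "distinct (concat (rev (rruns \<tau>)))" using assms(1) by (simp add: concat_rev_rruns)
  then have *: "distinct (rruns \<tau>)"
    "\<forall>ys zs. ys \<in> set (rruns \<tau>) \<and> zs \<in> set (rruns \<tau>) \<and> ys \<noteq> zs \<longrightarrow> set ys \<inter> set zs = {}"
    using rruns_Nil_notin[of \<tau>] by (simp_all add: distinct_concat_iff removeAll_id)
  then have "rruns \<tau> ! i \<noteq> rruns \<tau> ! j" using assms by (simp add: nth_eq_iff_index_eq)
  then show ?thesis using *(2) assms nth_mem by blast
qed

lemma runidx_eq:
  assumes "distinct \<tau>" "j < length (rruns \<tau>)" "c \<in> set (rruns \<tau> ! j)"
  shows "runidx \<tau> c = j"
  unfolding runidx_def
proof (rule the_equality)
  show "j < length (rruns \<tau>) \<and> c \<in> set (rruns \<tau> ! j)" using assms by simp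
  show "i = j" if "i < length (rruns \<tau>) \<and> c \<in> set (rruns \<tau> ! i)" for i
    using rruns_disjoint[OF assms(1), of i j] that assms(2,3) by blast
qed

lemma runidx_mem:
  assumes "distinct \<tau>" "c \<in> set \<tau>"
  shows "runidx \<tau> c < length (rruns \<tau>)" "c \<in> set (rruns \<tau> ! runidx \<tau> c)"
proof -
  obtain j where "j < length (rruns \<tau>)" "c \<in> set (rruns \<tau> ! j)"
    using assms(2) UN_rruns[of \<tau>] by blast
  then show "runidx \<tau> c < length (rruns \<tau>)" "c \<in> set (rruns \<tau> ! runidx \<tau> c)"
    using runidx_eq[OF assms(1)] by auto
qed

lemma runidx_fiber:
  assumes "distinct \<tau>" "j < length (rruns \<tau>)"
  shows "{c \<in> set \<tau>. runidx \<tau> c = j} = set (rruns \<tau> ! j)"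
proof (intro equalityI subsetI)
  fix c assume "c \<in> set (rruns \<tau> ! j)"
  moreover from this have "c \<in> set \<tau>" using UN_rruns[of \<tau>] assms(2) by blast
  ultimately show "c \<in> {c \<in> set \<tau>. runidx \<tau> c = j}" using runidx_eq[OF assms] by simp
qed (use runidx_mem(2)[OF assms(1)] in auto)

lemma sum_runs:
  fixes F :: "nat \<Rightarrow> 'b::comm_monoid_add"
  assumes "distinct \<tau>"
  shows "sum F (set \<tau>) = (\<Sum>j<length (rruns \<tau>). sum F (set (rruns \<tau> ! j)))"
proof -
  have "sum F (\<Union>j<length (rruns \<tau>). set (rruns \<tau> ! j))
    = (\<Sum>j<length (rruns \<tau>). sum F (set (rruns \<tau> ! j)))"
    using rruns_disjoint[OF assms] by (intro sum.UNION_disjoint) auto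
  then show ?thesis by (simp only: UN_rruns)
qed

lemma sum_runidx:
  assumes "distinct \<tau>" "\<tau> \<noteq> []"
  shows "sum (runidx \<tau>) (set \<tau>) = maj \<tau>"
proof -
  have "sum (runidx \<tau>) (set \<tau>) = (\<Sum>j<length (rruns \<tau>). j * length (rruns \<tau> ! j))"
    unfolding sum_runs[OF assms(1)]
  proof (rule sum.cong[OF refl])
    fix j assume "j \<in> {..<length (rruns \<tau>)}"
    then have j: "j < length (rruns \<tau>)" by simp
    have "sum (runidx \<tau>) (set (rruns \<tau> ! j)) = (\<Sum>c\<in>set (rruns \<tau> ! j). j)"
      using runidx_eq[OF assms(1) j] by simp
    then show "sum (runidx \<tau>) (set (rruns \<tau> ! j)) = j * length (rruns \<tau> ! j)"
      using card_rruns[OF j] by (simp add: rho_def)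
  qed
  also have "\<dots> = maj \<tau>"
    using maj_eq_wlen[OF assms] wlen_eq[of "runs \<tau>"] by (simp add: rruns_def)
  finally show ?thesis .
qed

text \<open>With run \<open>j\<close> placed in diagonal \<open>j - l\<close>, these are the cars in
  negative diagonals.\<close>

lemma card_low_runs:
  assumes "distinct \<tau>" "l \<le> length (rruns \<tau>)"
  shows "card {c \<in> set \<tau>. runidx \<tau> c < l} = (\<Sum>j<l. rho \<tau> j)"
proof -
  have "{c \<in> set \<tau>. runidx \<tau> c < l} = (\<Union>j<l. set (rruns \<tau> ! j))"
  proof -
    have "{c \<in> set \<tau>. runidx \<tau> c < l} = (\<Union>j<l. {c \<in> set \<tau>. runidx \<tau> c = j})" by auto
    also have "\<dots> = (\<Union>j<l. set (rruns \<tau> ! j))"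
      using runidx_fiber[OF assms(1)] assms(2) by (intro SUP_cong) auto
    finally show ?thesis .
  qed
  also have "card \<dots> = (\<Sum>j<l. card (set (rruns \<tau> ! j)))"
    using rruns_disjoint[OF assms(1)] assms(2) by (intro card_UN_disjoint) auto
  finally show ?thesis using card_rruns assms(2) by simp
qed

lemma length_rruns_le:
  "length (rruns \<tau>) \<le> length \<tau>"
proof -
  have "[] \<notin> set rs \<Longrightarrow> length rs \<le> length (concat rs)" for rs :: "nat list list"
  proof (induction rs)
    case (Cons r rs)
    then have "1 \<le> length r" by (cases r) auto
    then show ?case using Cons by simp
  qed simp
  from this[OF Nil_notin_runs[of \<tau>]] show ?thesis by (simp add: rruns_def)
qed

section \<open>The diagonal word of a preference function\<close>

abbreviation dlist :: "nat \<Rightarrow> (nat \<Rightarrow> nat) \<Rightarrow> int \<Rightarrow> nat list" where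
  "dlist n f m \<equiv> sorted_list_of_set {c \<in> {1..n}. diag n f c = m}"

lemma diag_bounds:
  assumes "f \<in> {1..n} \<rightarrow>\<^sub>E {1..n}" "c \<in> {1..n}"
  shows "- int n \<le> diag n f c \<and> diag n f c \<le> int n"
proof -
  have "card {x \<in> {1..n}. before f x c} \<le> card {1..n}" by (intro card_mono) auto
  moreover have "f c \<in> {1..n}" using assms by (rule PiE_mem)
  ultimately show ?thesis by (auto simp: diag_def colx_def rowy_eq)
qed

lemma diagword_eq:
  assumes "- int n \<le> a" "a \<le> b" "b \<le> int n" "\<And>c. c \<in> {1..n} \<Longrightarrow> a \<le> diag n f c \<and> diag n f c \<le> b"
  shows "diagword n f = concat (map (dlist n f) (rev [a..b]))"
proof -
  have "[- int n..int n] = [- int n..a - 1] @ [a..int n]"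
    using assms by (intro upto_split1) auto
  also have "[a..int n] = [a..b] @ [b+1..int n]"
    using assms by (intro upto_split2) auto
  finally have split: "[- int n..int n] = [- int n..a - 1] @ [a..b] @ [b+1..int n]" .
  have "dlist n f m = []" if "m < a \<or> b < m" for m
  proof -
    have "{c \<in> {1..n}. diag n f c = m} = {}" using assms(4) that by fastforce
    then show ?thesis by simp
  qed
  then have "concat (map (dlist n f) (rev [- int n..a - 1])) = []"
    "concat (map (dlist n f) (rev [b+1..int n])) = []"
    by auto
  then show ?thesis unfolding diagword_def split
    by (simp only: rev_append map_append concat_append append_Nil append_Nil2)
qed

text \<open>A discrete intermediate value argument: diagonals rise by at most one, so a step from at
  most \<open>m\<close> to above \<open>m\<close> goes from \<open>m\<close> to
  \<open>m + 1\<close>, and then \<open>adj\<close> makes the label grow.\<close>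

lemma word_crosses:
  assumes "successively (adj d e) (x # xs)" "d x \<le> m" "y \<in> set xs" "m < d y"
  shows "\<exists>u\<in>set (x # xs). \<exists>v\<in>set (x # xs). d u = m \<and> d v = m + 1 \<and> e u < e v"
  using assms
proof (induction xs arbitrary: x)
  case (Cons z zs)
  show ?case
  proof (cases "d z \<le> m")
    case True
    then show ?thesis using Cons.IH[of z] Cons.prems by auto
  next
    case False
    then have "d x = m \<and> d z = m + 1 \<and> e x < e z"
      using Cons.prems by (auto simp: adj_def)
    then show ?thesis by auto
  qed
qed simp

text \<open>For \<open>m\<close> at least 0 the crossing is found between the first letter and
  \<open>c'\<close>, for negative \<open>m\<close> between \<open>c\<close> and the last letter;
  \<open>valid\<close> puts these end letters on the proper side of \<open>m\<close>. The result
  shows both that intermediate diagonals are occupied and that neighbouring ones are separated by a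
  descent.\<close>

lemma diagonals_descend:
  assumes w: "w \<in> words d e S" and c: "c \<in> S" "d c \<le> m" and c': "c' \<in> S" "m < d c'"
  shows "\<exists>u\<in>S. \<exists>v\<in>S. d u = m \<and> d v = m + 1 \<and> e u < e v"
proof -
  have w: "set w = S" "successively (adj d e) w" "w \<noteq> []" "d (hd w) \<le> 0" "0 \<le> d (last w)"
    using w c(1) by (auto simp: words_def permutations_of_set_def valid_def)
  show ?thesis
  proof (cases "0 \<le> m")
    case True
    obtain x xs where x: "w = x # xs" using w(3) by (cases w) auto
    then have "d x \<le> m" using w(4) True by simp
    then have "c' \<in> set xs" using c' w(1) x by auto
    then show ?thesis using word_crosses[of d e x xs m c'] w x c' \<open>d x \<le> m\<close> by auto
  next
    case False
    obtain us xs where x: "w = us @ c # xs" using c(1) w(1) by (meson split_list)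
    then have "xs \<noteq> []" using False w(5) c by auto
    then have "last w \<in> set xs" using x by simp
    moreover have "successively (adj d e) (c # xs)"
      using w(2) x by (simp add: successively_append_iff)
    ultimately obtain u v where "u \<in> set (c # xs)" "v \<in> set (c # xs)" "d u = m \<and> d v = m + 1 \<and> e u < e v"
      using word_crosses[of d e c xs m "last w"] c w(5) False by force
    then show ?thesis using w(1) x by auto
  qed
qed

lemma sorted_hd_le_last:
  fixes xs :: "'a::linorder list"
  assumes "sorted xs" "x \<in> set xs"
  shows "hd xs \<le> x" "x \<le> last xs"
proof -
  show "hd xs \<le> x" using assms by (cases xs) auto
  show "x \<le> last xs" using assms by (cases xs rule: rev_cases) (auto simp: sorted_append)
qed

lemma runs_diagword:
  assumes f: "f \<in> {1..n} \<rightarrow>\<^sub>E {1..n}" and "1 \<le> n"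
  defines "a \<equiv> Min (diag n f ` {1..n})" and "b \<equiv> Max (diag n f ` {1..n})"
  shows "rruns (diagword n f) = map (dlist n f) [a..b]"
proof -
  let ?D = "diag n f ` {1..n}"
  have D: "finite ?D" "?D \<noteq> {}" using \<open>1 \<le> n\<close> by auto
  have ab: "a \<in> ?D" "b \<in> ?D" unfolding a_def b_def using D by (auto intro!: Min_in Max_in)
  have bd: "a \<le> diag n f c \<and> diag n f c \<le> b" if "c \<in> {1..n}" for c
    unfolding a_def b_def using D that by auto
  obtain ca cb where c: "ca \<in> {1..n}" "diag n f ca = a" "cb \<in> {1..n}" "diag n f cb = b"
    using ab by blast
  have "a \<le> b" using bd[OF c(1)] c(2) by simp
  have desc: "\<exists>u\<in>{1..n}. \<exists>v\<in>{1..n}. diag n f u = m \<and> diag n f v = m + 1 \<and> int u < int v"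
    if "a \<le> m" "m < b" for m
    using diagonals_descend[OF readword_in_words[OF f], of ca m cb] c that by simp
  have ne: "\<exists>u\<in>{1..n}. diag n f u = m" if "a \<le> m" "m \<le> b" for m
    using desc[of m] that c(3,4) by (cases "m = b") auto
  have "runs (concat (map (dlist n f) (rev [a..b]))) = map (dlist n f) (rev [a..b])"
  proof (rule runs_concat)
    fix r assume "r \<in> set (map (dlist n f) (rev [a..b]))"
    then obtain m where m: "r = dlist n f m" "m \<in> {a..b}"
      unfolding set_map set_rev set_upto by (rule imageE)
    then have "\<exists>u\<in>{1..n}. diag n f u = m" by (intro ne) simp_all
    then obtain u where "u \<in> {1..n}" "diag n f u = m" by (rule bexE)
    then have "u \<in> set r" using m(1) by simp
    then show "r \<noteq> [] \<and> sorted_wrt (<) r"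
      using m(1) strict_sorted_list_of_set by auto
  next
    \<comment> \<open>The last car of the upper diagonal is at least \<open>v\<close>, the first car
      of the lower one at most \<open>u\<close>, and \<open>u < v\<close>.\<close>
    have hl: "\<not> last (dlist n f (m + 1)) < hd (dlist n f m)" if m: "a \<le> m" "m < b" for m
    proof -
      obtain u v where "u \<in> {1..n}" "v \<in> {1..n}" "diag n f u = m" "diag n f v = m + 1" "int u < int v"
        using desc[OF m] by (elim bexE conjE)
      then have uv: "u \<in> set (dlist n f m)" "v \<in> set (dlist n f (m + 1))" "u < v" by simp_all
      then show ?thesis
        using sorted_hd_le_last(1)[OF sorted_sorted_list_of_set uv(1)]
          sorted_hd_le_last(2)[OF sorted_sorted_list_of_set uv(2)] by linarith
    qed
    have "successively (\<lambda>x y. \<not> last (dlist n f y) < hd (dlist n f x)) [a..b]"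
      unfolding successively_nth
    proof (intro allI impI)
      fix i assume i: "Suc i < length [a..b]"
      then have nth: "[a..b] ! i = a + int i" "[a..b] ! Suc i = a + int i + 1"
        by (simp_all add: nth_upto)
      show "\<not> last (dlist n f ([a..b] ! Suc i)) < hd (dlist n f ([a..b] ! i))"
        unfolding nth using i by (intro hl) simp_all
    qed
    then show "successively (\<lambda>r s. \<not> last r < hd s) (map (dlist n f) (rev [a..b]))"
      by (simp add: successively_map)
  qed
  moreover have "- int n \<le> a" "b \<le> int n"
    using diag_bounds[OF f c(1)] diag_bounds[OF f c(3)] c by auto
  ultimately show ?thesis
    using diagword_eq[of n a b f] bd \<open>a \<le> b\<close> by (simp add: rruns_def rev_map)
qed

text \<open>Trades the conditions on \<open>f\<close> for prescribed diagonals. By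
  \<open>runs_diagword\<close>, run \<open>j\<close> from the right is diagonal
  \<open>a + j\<close>, where \<open>a\<close> is the lowest diagonal, and the deviation is
  \<open>- a\<close>. Conversely, the prescribed diagonals list exactly the runs of \<tau>.\<close>

lemma diagword_dev_iff:
  assumes f: "f \<in> {1..n} \<rightarrow>\<^sub>E {1..n}" and "1 \<le> n" and \<tau>: "distinct \<tau>" "set \<tau> = {1..n}"
    and l: "l < length (rruns \<tau>)"
  shows "diagword n f = \<tau> \<and> dev n f = int l \<longleftrightarrow>
    (\<forall>c\<in>{1..n}. diag n f c = int (runidx \<tau> c) - int l)"
proof (intro iffI conjI ballI)
  fix c assume *: "diagword n f = \<tau> \<and> dev n f = int l" and c: "c \<in> {1..n}"
  let ?D = "diag n f ` {1..n}"
  define a b where "a = Min ?D" and "b = Max ?D"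
  have D: "finite ?D" "?D \<noteq> {}" using \<open>1 \<le> n\<close> by auto
  have bd: "a \<le> diag n f c \<and> diag n f c \<le> b"
    unfolding a_def b_def using D c by auto
  have R: "rruns \<tau> = map (dlist n f) [a..b]"
    using runs_diagword[OF f \<open>1 \<le> n\<close>] * by (simp add: a_def b_def)
  define j where "j = nat (diag n f c - a)"
  have j: "j < length [a..b]" "[a..b] ! j = diag n f c"
    using bd by (auto simp: j_def nth_upto)
  then have "runidx \<tau> c = j"
    using c by (intro runidx_eq[OF \<tau>(1)]) (auto simp: R)
  moreover have "dev n f = - a"
  proof -
    have "Max (uminus ` ?D) = - Min ?D"
      using D by (intro Max_eqI) (auto intro!: Min_in)
    then show ?thesis by (simp add: dev_def a_def image_image)
  qed
  ultimately show "diag n f c = int (runidx \<tau> c) - int l"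
    using * bd by (simp add: j_def)
next
  assume d: "\<forall>c\<in>{1..n}. diag n f c = int (runidx \<tau> c) - int l"
  let ?k = "length (rruns \<tau>)"
  have "length \<tau> = n" using \<tau> distinct_card by fastforce
  then have k: "?k \<le> n" using length_rruns_le[of \<tau>] by simp
  have bd: "- int l \<le> diag n f c \<and> diag n f c \<le> int ?k - 1 - int l" if "c \<in> {1..n}" for c
    using d that runidx_mem(1)[OF \<tau>(1), of c] \<tau>(2) by force
  have "map (dlist n f) [- int l..int ?k - 1 - int l] = rruns \<tau>"
  proof (rule nth_equalityI)
    show "length (map (dlist n f) [- int l..int ?k - 1 - int l]) = ?k" by simp
    fix i assume "i < length (map (dlist n f) [- int l..int ?k - 1 - int l])"
    then have i: "i < ?k" by simp
    have "{c \<in> {1..n}. diag n f c = - int l + int i} = set (rruns \<tau> ! i)"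
      using d \<tau>(2) unfolding runidx_fiber[OF \<tau>(1) i, symmetric] by auto
    then show "map (dlist n f) [- int l..int ?k - 1 - int l] ! i = rruns \<tau> ! i"
      using i sorted_rruns[OF i]
      by (simp add: nth_upto sorted_list_of_set.idem_if_sorted_distinct strict_sorted_iff)
  qed
  moreover have "diagword n f = concat (map (dlist n f) (rev [- int l..int ?k - 1 - int l]))"
    using bd k l by (intro diagword_eq) auto
  ultimately show "diagword n f = \<tau>"
    by (simp only: rev_map[symmetric] concat_rev_rruns)
  \<comment> \<open>The last run is nonempty and lies in diagonal \<open>- l\<close>, so the maximum
    defining the deviation is attained.\<close>
  have "rruns \<tau> ! 0 \<noteq> []" using l rruns_Nil_notin[of \<tau>] nth_mem[of 0 "rruns \<tau>"] by force
  then obtain c where c: "c \<in> set (rruns \<tau> ! 0)" by (meson ex_in_conv set_empty)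
  moreover have "{c \<in> set \<tau>. runidx \<tau> c = 0} = set (rruns \<tau> ! 0)"
    using l by (intro runidx_fiber[OF \<tau>(1)]) linarith
  ultimately have "c \<in> {1..n}" "runidx \<tau> c = 0"
    using \<tau>(2) by blast+
  then have "int l \<in> (\<lambda>c. - diag n f c) ` {1..n}" using d by force
  then show "dev n f = int l"
    unfolding dev_def using bd by (intro Max_eqI) fastforce+
qed

section \<open>Schedule numbers\<close>

abbreviation rset :: "nat list \<Rightarrow> nat \<Rightarrow> nat set" where
  "rset \<tau> j \<equiv> set (rruns \<tau> ! j)"

text \<open>The schedule number of an element of the higher run \<open>A\<close>, and also the \<open>l\<close>-schedule number
  of an element of the lower run \<open>B\<close> in a negative diagonal.\<close>
definition cross :: "nat set \<Rightarrow> nat set \<Rightarrow> nat \<Rightarrow> nat" where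
  "cross A B c = card {x \<in> A. c < x} + card {y \<in> B. y < c}"

text \<open>The names \<open>up\<close> and \<open>down\<close> refer to the upper and the lower of
  the two runs, not to the direction of the walk: \<open>up\<close> collects its downward steps and
  \<open>down\<close> its upward steps.\<close>

definition up :: "nat list \<Rightarrow> nat \<Rightarrow> nat multiset" where
  "up \<tau> j = image_mset (cross (rset \<tau> (Suc j)) (rset \<tau> j)) (mset_set (rset \<tau> (Suc j)))"

definition down :: "nat list \<Rightarrow> nat \<Rightarrow> nat multiset" where
  "down \<tau> j = image_mset (cross (rset \<tau> (Suc j)) (rset \<tau> j)) (mset_set (rset \<tau> j))"

text \<open>\<open>crossing_multiset\<close> for each pair of neighbouring runs; the initial
  segments of the intermediate runs cancel.\<close>

lemma up_down_telescope:
  assumes "distinct \<tau>" "m < length (rruns \<tau>)"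
  shows "(\<Sum>j<m. up \<tau> j) + mset_set {..<rho \<tau> 0} = (\<Sum>j<m. down \<tau> j) + mset_set {..<rho \<tau> m}"
  using assms(2)
proof (induction m)
  case (Suc m)
  have "up \<tau> m + mset_set {..<rho \<tau> m} = down \<tau> m + mset_set {..<rho \<tau> (Suc m)}"
    using crossing_multiset[of "rset \<tau> (Suc m)" "rset \<tau> m"] rruns_disjoint[OF assms(1), of "Suc m" m] Suc.prems
    by (simp add: up_def down_def cross_def[abs_def] card_rruns)
  then show ?case using Suc by (simp add: ac_simps)
qed simp

lemma length_dropWhile_distinct:
  "distinct xs \<Longrightarrow> image_mset (\<lambda>c. length (dropWhile (\<lambda>x. x \<noteq> c) xs)) (mset xs) = mset_set {1..length xs}"
proof (induction xs)
  case (Cons x xs)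
  have "image_mset (\<lambda>c. length (dropWhile (\<lambda>y. y \<noteq> c) (x # xs))) (mset xs)
      = image_mset (\<lambda>c. length (dropWhile (\<lambda>y. y \<noteq> c) xs)) (mset xs)"
    using Cons.prems by (intro image_mset_cong) auto
  then show ?case using Cons by (simp add: atLeastAtMostSuc_conv)
qed simp

text \<open>Matches the slots of a car in diagonal 0: one for each larger car of its run and one for
  the front of the word.\<close>

lemma length_dropWhile_sorted:
  "sorted_wrt (<) xs \<Longrightarrow> c \<in> set xs \<Longrightarrow>
    length (dropWhile (\<lambda>x. x \<noteq> c) xs) = Suc (card {x \<in> set xs. c < (x::'a::linorder)})"
proof (induction xs)
  case (Cons x xs)
  show ?case
  proof (cases "x = c")
    case True
    then have "{y \<in> set (x # xs). c < y} = set xs" using Cons.prems by auto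
    moreover have "distinct xs" using Cons.prems by (simp add: strict_sorted_iff)
    ultimately show ?thesis using True by (simp add: distinct_card)
  next
    case False
    then have "{y \<in> set (x # xs). c < y} = {y \<in> set xs. c < y}" using Cons.prems by auto
    then show ?thesis using Cons False by simp
  qed
qed simp

text \<open>Passes between the initial segments of the telescoped identity and the numbers from 1 to
  \<open>k\<close> on a run. This exchange is the source of the two run lengths in the final
  multiset identity.\<close>

lemma mset_set_add_0: "add_mset 0 (mset_set {1..k}) = add_mset (k::nat) (mset_set {..<k})"
proof -
  have "add_mset 0 (mset_set {1..k}) = mset_set {..k}"
    by (simp add: atMost_atLeast0 atLeastAtMost_insertL[of 0 k, symmetric])
  also have "\<dots> = add_mset k (mset_set {..<k})"
    by (simp flip: lessThan_Suc_atMost add: lessThan_Suc)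
  finally show ?thesis .
qed

lemma image_mset_distinct: "distinct xs \<Longrightarrow> image_mset F (mset xs) = (\<Sum>c\<in>set xs. {#F c#})"
  by (induction xs) auto

lemma lsched_on_run:
  assumes "distinct \<tau>" "j < length (rruns \<tau>)" "c \<in> rset \<tau> j"
  shows "lsched l \<tau> c = (if j < l then cross (rset \<tau> (Suc j)) (rset \<tau> j) c
    else if j = l then length (dropWhile (\<lambda>x. x \<noteq> c) (rruns \<tau> ! j))
    else cross (rset \<tau> j) (rset \<tau> (j - 1)) c)"
  using runidx_eq[OF assms] by (simp add: lsched_def cross_def Let_def)

lemma image_mset_runs:
  assumes "distinct \<tau>"
  shows "image_mset F (mset \<tau>) = (\<Sum>j<length (rruns \<tau>). image_mset F (mset (rruns \<tau> ! j)))"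
  unfolding image_mset_distinct[OF assms] sum_runs[OF assms]
  by (intro sum.cong) (simp_all add: image_mset_distinct distinct_rruns)

lemma mset_lsched:
  assumes "distinct \<tau>" "l < length (rruns \<tau>)"
  shows "image_mset (lsched l \<tau>) (mset \<tau>) =
    (\<Sum>j<l. down \<tau> j) + mset_set {1..rho \<tau> l} + (\<Sum>j\<in>{l..<length (rruns \<tau>) - 1}. up \<tau> j)"
proof -
  define T where "T j = image_mset (lsched l \<tau>) (mset (rruns \<tau> ! j))" for j
  have split: "image_mset (lsched l \<tau>) (mset \<tau>) = (\<Sum>j<length (rruns \<tau>). T j)"
    unfolding T_def by (rule image_mset_runs[OF assms(1)])
  have T1: "T j = down \<tau> j" if "j < l" for j
    using that assms lsched_on_run[OF assms(1), of j _ l] distinct_rruns[of j \<tau>]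
    by (auto simp: T_def down_def mset_set_set intro!: image_mset_cong)
  have T2: "T l = mset_set {1..rho \<tau> l}"
    unfolding rho_def length_dropWhile_distinct[OF distinct_rruns[OF assms(2)], symmetric] T_def
    using lsched_on_run[OF assms, of _ l] by (intro image_mset_cong) auto
  have T3: "T (Suc j) = up \<tau> j" if "l \<le> j" "Suc j < length (rruns \<tau>)" for j
    using that assms lsched_on_run[OF assms(1), of "Suc j" _ l] distinct_rruns[of "Suc j" \<tau>]
    by (auto simp: T_def up_def mset_set_set intro!: image_mset_cong)
  have main: "(\<Sum>j<Suc (l + p). T j) =
      (\<Sum>j<l. down \<tau> j) + mset_set {1..rho \<tau> l} + (\<Sum>j\<in>{l..<l + p}. up \<tau> j)"
    if "l + p < length (rruns \<tau>)" for p
    using that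
  proof (induction p)
    case 0
    then show ?case using T1 T2 by simp
  next
    case (Suc p)
    then show ?case using T3[of "l + p"] by simp
  qed
  obtain p where p: "length (rruns \<tau>) = Suc (l + p)"
    using less_imp_Suc_add[OF assms(2)] by auto
  have "(\<Sum>j<length (rruns \<tau>). T j) =
      (\<Sum>j<l. down \<tau> j) + mset_set {1..rho \<tau> l} + (\<Sum>j\<in>{l..<length (rruns \<tau>) - 1}. up \<tau> j)"
    using main[of p] by (simp only: p) simp
  then show ?thesis using split by simp
qed

lemma last_runs: "\<tau> \<noteq> [] \<Longrightarrow> last (runs \<tau>) = rruns \<tau> ! 0"
  using runs_ne_Nil[of \<tau>] by (simp add: rruns_def rev_nth last_conv_nth)

text \<open>Beyond the last run, \<open>schedule\<close> reads \<tau> backwards and visits every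
  remaining letter once, so its entries can be regrouped by runs.\<close>

lemma mset_schedule:
  assumes "distinct \<tau>" "\<tau> \<noteq> []"
  shows "mset (schedule \<tau>) = mset_set {1..rho \<tau> 0} + (\<Sum>j<length (rruns \<tau>) - 1. up \<tau> j)"
proof -
  define n where "n = length \<tau>"
  define k where "k = rho \<tau> 0"
  \<comment> \<open>On the last run \<open>runidx \<tau> c - 1\<close> is truncated to 0 and
    \<open>F\<close> is not a schedule number. These values appear on both sides at the end and
    cancel.\<close>
  define F where "F c = card {y \<in> rset \<tau> (runidx \<tau> c). c < y} + card {y \<in> rset \<tau> (runidx \<tau> c - 1). y < c}" for c
  have rne: "rruns \<tau> \<noteq> []" using runs_ne_Nil[OF assms(2)] by (simp add: rruns_def)
  then obtain R0 R where R: "rruns \<tau> = R0 # R" by (cases "rruns \<tau>") auto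
  have \<tau>: "\<tau> = concat (rev R) @ R0" using concat_rev_rruns[of \<tau>] R by simp
  have kR: "k = length R0" by (simp add: k_def rho_def R)
  have kn: "k \<le> n" using \<tau> kR by (simp add: n_def)
  have s: "sched \<tau> i = (if i \<le> k then i else F (\<tau> ! (n - i)))" for i
    by (simp add: sched_def F_def n_def k_def rho_def last_runs[OF assms(2)] Let_def)
  have "[1..<n + 1] = [1..<k + 1] @ [k + 1..<n + 1]"
    using kn upt_add_eq_append[of 1 "k + 1" "n - k"] by simp
  then have "mset (schedule \<tau>) = image_mset (sched \<tau>) (mset [1..<k + 1]) + image_mset (sched \<tau>) (mset [k + 1..<n + 1])"
    by (simp add: schedule_def n_def del: upt_Suc)
  also have "image_mset (sched \<tau>) (mset [1..<k + 1]) = image_mset (\<lambda>i. i) (mset [1..<k + 1])"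
    by (intro image_mset_cong) (auto simp: s)
  also have "\<dots> = mset_set {1..k}"
    by (simp add: atLeastLessThanSuc_atLeastAtMost del: upt_Suc)
  also have "image_mset (sched \<tau>) (mset [k + 1..<n + 1]) = mset (map (\<lambda>i. F (\<tau> ! (n - i))) [k + 1..<n + 1])"
    unfolding mset_map by (intro image_mset_cong) (auto simp: s)
  also have "map (\<lambda>i. F (\<tau> ! (n - i))) [k + 1..<n + 1] = map F (rev (concat (rev R)))"
  proof (rule nth_equalityI)
    have len: "length (concat (rev R)) = n - k" using \<tau> kR by (simp add: n_def)
    show "length (map (\<lambda>i. F (\<tau> ! (n - i))) [k + 1..<n + 1]) = length (map F (rev (concat (rev R))))"
      using len by (simp del: upt_Suc)
    fix i assume "i < length (map (\<lambda>i. F (\<tau> ! (n - i))) [k + 1..<n + 1])"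
    then have i: "i < n - k" by (simp del: upt_Suc)
    then have "n - (k + 1 + i) < length (concat (rev R))" unfolding len by linarith
    then have "\<tau> ! (n - (k + 1 + i)) = concat (rev R) ! (n - (k + 1 + i))"
      by (subst \<tau>) (simp only: nth_append if_True)
    then show "map (\<lambda>i. F (\<tau> ! (n - i))) [k + 1..<n + 1] ! i = map F (rev (concat (rev R))) ! i"
      using i len by (simp add: rev_nth del: upt_Suc)
  qed
  also have "mset (map F (rev (concat (rev R)))) = (\<Sum>j<length (rruns \<tau>) - 1. up \<tau> j)"
  proof -
    have "image_mset F (mset \<tau>) = (\<Sum>j<length (rruns \<tau>). image_mset F (mset (rruns \<tau> ! j)))"
      by (rule image_mset_runs[OF assms(1)])
    also have "\<dots> = image_mset F (mset R0) + (\<Sum>j<length R. image_mset F (mset (rruns \<tau> ! Suc j)))"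
      by (simp add: R sum.lessThan_Suc_shift del: sum.lessThan_Suc)
    also have "(\<Sum>j<length R. image_mset F (mset (rruns \<tau> ! Suc j))) = (\<Sum>j<length R. up \<tau> j)"
    proof (rule sum.cong[OF refl])
      fix j assume "j \<in> {..<length R}"
      then have j: "Suc j < length (rruns \<tau>)" by (simp add: R)
      show "image_mset F (mset (rruns \<tau> ! Suc j)) = up \<tau> j"
        unfolding up_def mset_set_set[OF distinct_rruns[OF j]]
        using runidx_eq[OF assms(1) j] by (intro image_mset_cong) (simp add: F_def cross_def)
    qed
    finally have "image_mset F (mset (concat (rev R))) + image_mset F (mset R0)
        = (\<Sum>j<length R. up \<tau> j) + image_mset F (mset R0)"
      unfolding arg_cong[OF \<tau>, of "\<lambda>x. image_mset F (mset x)"] by (simp add: add.commute)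
    then show ?thesis by (simp add: R)
  qed
  finally show ?thesis by (simp add: k_def)
qed

text \<open>The runs above index \<open>l\<close> contribute the same \<open>?U\<close> to both
  sides, and telescoping compares the rest. The additive form avoids multiset subtraction; an
  auxiliary 0 makes \<open>mset_set_add_0\<close> applicable and is cancelled at the end.\<close>

lemma mset_lsched_schedule:
  assumes "distinct \<tau>" "l < length (rruns \<tau>)"
  shows "add_mset (rho \<tau> 0) (image_mset (lsched l \<tau>) (mset \<tau>)) = add_mset (rho \<tau> l) (mset (schedule \<tau>))"
proof -
  have ne: "\<tau> \<noteq> []" using assms(2) by (auto simp: rruns_def)
  let ?U = "\<Sum>j\<in>{l..<length (rruns \<tau>) - 1}. up \<tau> j"
  have "{..<length (rruns \<tau>) - 1} = {..<l} \<union> {l..<length (rruns \<tau>) - 1}"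
    using assms(2) by auto
  then have "(\<Sum>j<length (rruns \<tau>) - 1. up \<tau> j) = (\<Sum>j<l. up \<tau> j) + ?U"
    by (simp add: sum.union_disjoint ivl_disj_int)
  then have "add_mset 0 (add_mset (rho \<tau> l) (mset (schedule \<tau>)))
      = add_mset (rho \<tau> l) (add_mset 0 (mset_set {1..rho \<tau> 0})) + (\<Sum>j<l. up \<tau> j) + ?U"
    unfolding mset_schedule[OF assms(1) ne] by (simp add: add_mset_commute add.assoc)
  also have "\<dots> = add_mset (rho \<tau> l) (add_mset (rho \<tau> 0) ((\<Sum>j<l. up \<tau> j) + mset_set {..<rho \<tau> 0})) + ?U"
    unfolding mset_set_add_0 by (simp add: ac_simps)
  also have "\<dots> = add_mset (rho \<tau> 0) (add_mset (rho \<tau> l) (mset_set {..<rho \<tau> l})) + (\<Sum>j<l. down \<tau> j) + ?U"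
    unfolding up_down_telescope[OF assms] by (simp add: ac_simps add_mset_commute)
  also have "\<dots> = add_mset 0 (add_mset (rho \<tau> 0) (image_mset (lsched l \<tau>) (mset \<tau>)))"
    unfolding mset_set_add_0[symmetric] mset_lsched[OF assms]
    by (simp add: ac_simps add_mset_commute)
  finally show ?thesis by simp
qed

text \<open>Identifies the factors of \<open>wsum_eq_prod\<close>: below diagonal 0 the attackers of
  \<open>c\<close> are counted, above it the cars attacked by \<open>c\<close>, and in diagonal 0
  the larger cars of the run together with the front of the word.\<close>

lemma slots_eq_lsched:
  assumes "distinct \<tau>" "l < length (rruns \<tau>)" "c \<in> set \<tau>"
  shows "slots (\<lambda>c. int (runidx \<tau> c) - int l) int (set \<tau>) c = lsched l \<tau> c"
proof -
  let ?d = "\<lambda>c. int (runidx \<tau> c) - int l"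
  define j where "j = runidx \<tau> c"
  have j: "j < length (rruns \<tau>)" "c \<in> rset \<tau> j" using runidx_mem[OF assms(1,3)] by (auto simp: j_def)
  have two: "card ({x \<in> set \<tau>. runidx \<tau> x = i \<and> c < x} \<union> {x \<in> set \<tau>. runidx \<tau> x = i' \<and> x < c})
      = cross (rset \<tau> i) (rset \<tau> i') c"
    if "i < length (rruns \<tau>)" "i' < length (rruns \<tau>)" for i i'
  proof -
    have "card ({x \<in> set \<tau>. runidx \<tau> x = i \<and> c < x} \<union> {x \<in> set \<tau>. runidx \<tau> x = i' \<and> x < c})
      = card {x \<in> set \<tau>. runidx \<tau> x = i \<and> c < x} + card {x \<in> set \<tau>. runidx \<tau> x = i' \<and> x < c}"
      by (intro card_Un_disjoint) auto
    then show ?thesis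
      unfolding cross_def runidx_fiber[OF assms(1) that(1), symmetric]
        runidx_fiber[OF assms(1) that(2), symmetric]
      by (simp add: conj_assoc)
  qed
  consider "j < l" | "j = l" | "l < j" by linarith
  then show ?thesis
  proof cases
    case 1
    have "{x \<in> set \<tau>. attack ?d int x c}
      = {x \<in> set \<tau>. runidx \<tau> x = Suc j \<and> c < x} \<union> {x \<in> set \<tau>. runidx \<tau> x = j \<and> x < c}"
      by (auto simp: attack_def j_def)
    then show ?thesis
      using 1 two[of "Suc j" j] j assms(2) lsched_on_run[OF assms(1) j, of l]
      by (simp add: slots_def flip: j_def)
  next
    case 2
    have "{x \<in> set \<tau>. attack ?d int c x \<and> ?d x = 0} = {x \<in> rset \<tau> j. c < x}"
      unfolding runidx_fiber[OF assms(1) j(1), symmetric] using 2 by (auto simp: attack_def j_def)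
    then show ?thesis
      using 2 lsched_on_run[OF assms(1) j, of l] length_dropWhile_sorted[OF sorted_rruns[OF j(1)] j(2)]
      by (simp add: slots_def flip: j_def)
  next
    case 3
    have "{x \<in> set \<tau>. attack ?d int c x}
      = {x \<in> set \<tau>. runidx \<tau> x = j \<and> c < x} \<union> {x \<in> set \<tau>. runidx \<tau> x = j - 1 \<and> x < c}"
      using 3 by (auto simp: attack_def j_def)
    then show ?thesis
      using 3 two[of j "j - 1"] j lsched_on_run[OF assms(1) j, of l]
      by (simp add: slots_def flip: j_def)
  qed
qed

section \<open>The generating function\<close>

lemma area_eq_maj:
  assumes "distinct \<tau>" "\<tau> \<noteq> []" "set \<tau> = {1..n}"
    and "dev n f = int l" "\<forall>c\<in>{1..n}. diag n f c = int (runidx \<tau> c) - int l"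
  shows "area n f = int (maj \<tau>)"
proof -
  have "area n f = (\<Sum>c\<in>{1..n}. int (runidx \<tau> c))"
    unfolding area_def using assms(4,5) by (intro sum.cong) auto
  then show ?thesis
    using sum_runidx[OF assms(1,2)] assms(3) by (simp flip: of_nat_sum)
qed

theorem theorem3p1:
  fixes \<tau> :: "nat list" and n l :: nat and t q :: "'a::field"
  assumes "n \<ge> 1" and "distinct \<tau>" and "set \<tau> = {1..n}"
    and "1 \<le> l" and "l < length (runs \<tau>)"
  shows "mset (map (lsched l \<tau>) [1..<n+1]) = mset (schedule \<tau>) + {#rho \<tau> l#} - {#rho \<tau> 0#}
    \<and> (qint (rho \<tau> 0) q \<noteq> 0 \<longrightarrow>
       (\<Sum>f \<in> {f \<in> {1..n} \<rightarrow>\<^sub>E {1..n}. diagword n f = \<tau> \<and> dev n f = int l}.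
          t ^ nat (area n f) * q ^ dinv n f)
       = t ^ maj \<tau> * q ^ (\<Sum>j<l. rho \<tau> j) * (qint (rho \<tau> l) q / qint (rho \<tau> 0) q)
         * (\<Prod>i\<in>{1..n}. qint (sched \<tau> i) q))"
proof (intro conjI impI)
  have l: "l < length (rruns \<tau>)" using assms(5) by (simp add: rruns_def)
  have ne: "\<tau> \<noteq> []" using assms(1,3) by auto
  have len: "length \<tau> = n" using assms(2,3) distinct_card by fastforce
  have m\<tau>: "mset [1..<n+1] = mset \<tau>"
    using assms(2,3) set_eq_iff_mset_eq_distinct[of "[1..<n+1]" \<tau>] by auto
  have eq: "add_mset (rho \<tau> 0) (mset (map (lsched l \<tau>) [1..<n+1])) = add_mset (rho \<tau> l) (mset (schedule \<tau>))"
    unfolding mset_map m\<tau> by (rule mset_lsched_schedule[OF assms(2) l])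
  then show "mset (map (lsched l \<tau>) [1..<n+1]) = mset (schedule \<tau>) + {#rho \<tau> l#} - {#rho \<tau> 0#}"
    by (metis add_mset_add_single add_mset_remove_trivial)
  assume nz: "qint (rho \<tau> 0) q \<noteq> 0"
  let ?Q = "\<lambda>M. prod_mset (image_mset (\<lambda>m. qint m q) M)"
  have prod: "(\<Prod>i\<in>{1..n}. qint (F i) q) = ?Q (mset (map F [1..<n+1]))" for F
    by (simp add: prod_unfold_prod_mset image_mset.compositionality comp_def
        atLeastLessThanSuc_atLeastAtMost del: upt_Suc)
  \<comment> \<open>The additive multiset identity becomes an identity of products, and
    \<open>nz\<close> allows dividing afterwards.\<close>
  have "qint (rho \<tau> 0) q * (\<Prod>i\<in>{1..n}. qint (lsched l \<tau> i) q)
      = ?Q (add_mset (rho \<tau> 0) (mset (map (lsched l \<tau>) [1..<n+1])))"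
    unfolding prod by simp
  also have "\<dots> = qint (rho \<tau> l) q * (\<Prod>i\<in>{1..n}. qint (sched \<tau> i) q)"
    unfolding eq prod by (simp add: schedule_def len del: upt_Suc)
  finally have P: "(\<Prod>i\<in>{1..n}. qint (lsched l \<tau> i) q)
      = qint (rho \<tau> l) q / qint (rho \<tau> 0) q * (\<Prod>i\<in>{1..n}. qint (sched \<tau> i) q)"
    using nz by (simp add: field_simps)
  define d where "d c = int (runidx \<tau> c) - int l" for c
  let ?A = "{f \<in> {1..n} \<rightarrow>\<^sub>E {1..n}. diagword n f = \<tau> \<and> dev n f = int l}"
  have A: "?A = {f. f \<in> {1..n} \<rightarrow>\<^sub>E {1..n} \<and> (\<forall>c\<in>{1..n}. diag n f c = d c)}"
    using diagword_dev_iff[OF _ assms(1-3) l] unfolding d_def by blast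
  have "area n f = int (maj \<tau>)" if "f \<in> ?A" for f
  proof (rule area_eq_maj[OF assms(2) ne assms(3)])
    show "dev n f = int l" using that by simp
    show "\<forall>c\<in>{1..n}. diag n f c = int (runidx \<tau> c) - int l"
      using that unfolding A d_def by blast
  qed
  then have "(\<Sum>f\<in>?A. t ^ nat (area n f) * q ^ dinv n f) = t ^ maj \<tau> * (\<Sum>f\<in>?A. q ^ dinv n f)"
    unfolding sum_distrib_left by (intro sum.cong) simp_all
  also have "(\<Sum>f\<in>?A. q ^ dinv n f) = q ^ card {c \<in> {1..n}. d c < 0} * wsum d int q {1..n}"
    unfolding A by (rule sum_pref_eq_wsum)
  also have "{c \<in> {1..n}. d c < 0} = {c \<in> set \<tau>. runidx \<tau> c < l}"
    using assms(3) by (auto simp: d_def)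
  also have "card \<dots> = (\<Sum>j<l. rho \<tau> j)" using l by (intro card_low_runs[OF assms(2)]) simp
  \<comment> \<open>With \<open>S\<close> equal to \<open>U\<close> the closure hypotheses are
    trivial.\<close>
  also have "wsum d int q {1..n} = (\<Prod>c\<in>{1..n}. qint (slots d int {1..n} c) q)"
    by (rule wsum_eq_prod) auto
  also have "\<dots> = (\<Prod>c\<in>{1..n}. qint (lsched l \<tau> c) q)"
    using slots_eq_lsched[OF assms(2) l] assms(3) by (intro prod.cong) (simp_all add: d_def[abs_def])
  finally show "(\<Sum>f\<in>?A. t ^ nat (area n f) * q ^ dinv n f)
       = t ^ maj \<tau> * q ^ (\<Sum>j<l. rho \<tau> j) * (qint (rho \<tau> l) q / qint (rho \<tau> 0) q)
         * (\<Prod>i\<in>{1..n}. qint (sched \<tau> i) q)"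
    unfolding P by (simp add: mult.assoc)
qed

end
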